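(* Let $n\ge2$, $k\ge3$, let $\Omega_1$ and $\Omega_2$ be bounded pseudoconvex domains in $\mathbb{C}^n$ with $C^k$-smooth boundaries, and let $\rho$ be a $C^k$-smooth defining function of $\Omega_2$. Suppose that there exists a $C^k$-smooth CR-diffeomorphism $f:\partial\Omega_1\to\partial\Omega_2$. Denote again by $f$ a $C^k$-smooth extension of $f$ to a map $\mathbb{C}^n\to\mathbb{C}^n$ such that $\overline\partial f$ vanishes on $\partial\Omega_1$ to order $k-1$, so that $\rho\circ f$ is a defining function for $\Omega_1$ near $\partial\Omega_1$. Then $$\alpha_{(\rho\circ f)}(\overline{L})(p)=\alpha_{\rho}\big(\overline{f_*(L)}\big)(f(p)),$$ $$d^c\alpha_{(\rho\circ f)}(L,\overline{L})(p)=d^c\alpha_{\rho}\big(f_*(L),\overline{f_*(L)}\big)(f(p)),$$ for all $p\in\partial\Omega_1$ and $L\in\mathcal{N}_p$.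
   Context: Defining functions. A real function $\rho$ on a neighborhood $V$ of $\overline\Omega$ is a defining function of $\Omega$ if $\Omega=\{z\in V:\rho(z)<0\}$ and $d\rho\ne 0$ on $\partial\Omega$. Tangent spaces and Levi form. $T^{1,0}_p(\partial\Omega)$ is the space of vectors $L=\sum_j a_j\,\partial/\partial z_j$ at $p\in\partial\Omega$ with $\sum_j a_j\frac{\partial\rho}{\partial z_j}(p)=0$. The Levi-form is $\mathscr{L}_\rho(X,Y)=\sum_{j,k}\frac{\partial^2\rho}{\partial z_j\partial\bar z_k}X_j\overline{Y_k}$ for $(1,0)$ vectors $X,Y$. $\mathcal{N}_p\subset T^{1,0}_p(\partial\Omega_1)$ is the null-space at $p\in\partial\Omega_1$ of the Levi-form of $\partial\Omega_1$ restricted to $T^{1,0}_p(\partial\Omega_1)$. CR maps. A $C^k$-smooth map $F:\partial\Omega_1\to\partial\Omega_2$ is a CR-map if $F_*(T^{1,0}_p(\partial\Omega_1))\subset T^{1,0}_{F(p)}(\partial\Omega_2)$ for all $p\in\partial\Omega_1$, and a CR-diffeomorphism if it is a CR-map and a diffeomorphism. (An extension as in the claim exists by a known theorem on $C^k$ CR-functions; "$\overline\partial f$ vanishes on $\partial\Omega_1$ to order $k-1$" means that all $\partial f_j/\partial\bar z_m$ and their partial derivatives up to order $k-1$ vanish on $\partial\Omega_1$.) D'Angelo 1-form. For a $C^k$-smooth defining function $r$ put $$L_{n,r}:=\frac{1}{\sum_{j=1}^n|\partial r/\partial z_j|^2}\sum_{j=1}^n\frac{\partial r}{\partial\bar z_j}\frac{\partial}{\partial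 z_j},\qquad T_r:=L_{n,r}-\overline{L}_{n,r},\qquad \eta_r:=\tfrac12(\partial r-\overline\partial r).$$ The D'Angelo 1-form of $r$ is the real 1-form $\alpha_r:=-\mathcal{L}_{T_r}\eta_r$, with $\mathcal{L}_{T_r}$ the Lie derivative in the direction $T_r$; the same formula defines it on a neighborhood of the boundary where $\partial r\neq0$. Only $r$ near the boundary matters. Conventions: $d=\partial+\overline\partial$, $d^c=i(\overline\partial-\partial)$, and $(\beta\wedge\gamma)(X,Y)=\beta(X)\gamma(Y)-\beta(Y)\gamma(X)$. *)

theory Defs
  imports "HOL-Analysis.Analysis"
begin

section \<open>Smoothness\<close>

text \<open>
  Class \<open>C^k\<close> on an open set \<open>U\<close> of a Euclidean space, via real directional derivatives in
  all directions.
\<close>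

primrec Ck_on :: "nat \<Rightarrow> ('a::euclidean_space \<Rightarrow> 'b::real_normed_vector) \<Rightarrow> 'a set \<Rightarrow> bool" where
  "Ck_on 0 f U \<longleftrightarrow> continuous_on U f"
| "Ck_on (Suc k) f U \<longleftrightarrow>
     f differentiable_on U \<and> (\<forall>v. Ck_on k (\<lambda>x. frechet_derivative f (at x) v) U)"

definition Ck_on_subset :: "nat \<Rightarrow> ('a::euclidean_space \<Rightarrow> 'b::real_normed_vector) \<Rightarrow> 'a set \<Rightarrow> bool" where
  "Ck_on_subset k f S \<longleftrightarrow>
     (\<exists>U F. open U \<and> S \<subseteq> U \<and> Ck_on k F U \<and> (\<forall>x\<in>S. F x = f x))"

text \<open>All (real) partial derivatives of \<open>g\<close> of order at most \<open>m\<close>, including \<open>g\<close> itself, vanish on \<open>S\<close>.\<close>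

primrec vanishes_to_order :: "nat \<Rightarrow> ('a::euclidean_space \<Rightarrow> 'b::real_normed_vector) \<Rightarrow> 'a set \<Rightarrow> bool" where
  "vanishes_to_order 0 g S \<longleftrightarrow> (\<forall>x\<in>S. g x = 0)"
| "vanishes_to_order (Suc m) g S \<longleftrightarrow>
     (\<forall>x\<in>S. g x = 0) \<and> (\<forall>v. vanishes_to_order m (\<lambda>x. frechet_derivative g (at x) v) S)"


section \<open>Wirtinger derivatives and complexified tangent vectors\<close>

definition dz :: "'n::finite \<Rightarrow> (complex^'n \<Rightarrow> complex) \<Rightarrow> complex^'n \<Rightarrow> complex" where
  "dz j g p = (frechet_derivative g (at p) (axis j 1)
                 - \<i> * frechet_derivative g (at p) (axis j \<i>)) / 2"

definition dzbar :: "'n::finite \<Rightarrow> (complex^'n \<Rightarrow> complex) \<Rightarrow> complex^'n \<Rightarrow> complex" where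
  "dzbar j g p = (frechet_derivative g (at p) (axis j 1)
                 + \<i> * frechet_derivative g (at p) (axis j \<i>)) / 2"

text \<open>
  The pair \<open>(a, b)\<close> stands for \<open>\<Sum>j. a\<^sub>j \<partial>/\<partial>z\<^sub>j + b\<^sub>j \<partial>/\<partial>zbar\<^sub>j\<close>, an element of
  the complexified tangent space of \<open>\<complex>\<^sup>n\<close> at some point.  A complex 1-form is a function taking
  a point and such a vector, a vector field is a function from points to such vectors.
\<close>

type_synonym 'n cvec = "(complex^'n) \<times> (complex^'n)"

definition cvec_cnj :: "'n::finite cvec \<Rightarrow> 'n cvec" where
  "cvec_cnj X = ((\<chi> j. cnj (snd X $ j)), (\<chi> j. cnj (fst X $ j)))"

definition d10 :: "(complex^'n \<Rightarrow> complex) \<Rightarrow> complex^'n \<Rightarrow> 'n::finite cvec \<Rightarrow> complex" where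
  "d10 g p X = (\<Sum>j\<in>UNIV. fst X $ j * dz j g p)"

definition d01 :: "(complex^'n \<Rightarrow> complex) \<Rightarrow> complex^'n \<Rightarrow> 'n::finite cvec \<Rightarrow> complex" where
  "d01 g p X = (\<Sum>j\<in>UNIV. snd X $ j * dzbar j g p)"

text \<open>The action of the tangent vector \<open>X\<close> at \<open>p\<close> on functions, i.e. \<open>dg(X)\<close>.\<close>

definition cvec_act :: "'n::finite cvec \<Rightarrow> (complex^'n \<Rightarrow> complex) \<Rightarrow> complex^'n \<Rightarrow> complex" where
  "cvec_act X g p = d10 g p X + d01 g p X"

text \<open>The complexified differential: \<open>(F\<^sub>* X) g = X (g \<circ> F)\<close>, read off on \<open>g = w\<^sub>l\<close> and \<open>g = wbar\<^sub>l\<close>.\<close>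

definition pushforward :: "(complex^'n \<Rightarrow> complex^'n) \<Rightarrow> complex^'n \<Rightarrow> 'n::finite cvec \<Rightarrow> 'n cvec" where
  "pushforward F p X = ((\<chi> l. cvec_act X (\<lambda>z. F z $ l) p), (\<chi> l. cvec_act X (\<lambda>z. cnj (F z $ l)) p))"


section \<open>Domains, Levi form and CR maps\<close>

definition defining_function :: "nat \<Rightarrow> (complex^'n::finite \<Rightarrow> real) \<Rightarrow> (complex^'n) set \<Rightarrow> bool" where
  "defining_function k r \<Omega> \<longleftrightarrow>
     (\<exists>V. open V \<and> closure \<Omega> \<subseteq> V \<and> Ck_on k r V \<and> \<Omega> = {z\<in>V. r z < 0} \<and>
          (\<forall>p\<in>frontier \<Omega>. frechet_derivative r (at p) \<noteq> (\<lambda>v. 0)))"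

definition T10 :: "(complex^'n::finite \<Rightarrow> real) \<Rightarrow> complex^'n \<Rightarrow> 'n cvec set" where
  "T10 r p = {X. snd X = 0 \<and> (\<Sum>j\<in>UNIV. fst X $ j * dz j (\<lambda>z. complex_of_real (r z)) p) = 0}"

definition levi_form :: "(complex^'n::finite \<Rightarrow> real) \<Rightarrow> complex^'n \<Rightarrow> 'n cvec \<Rightarrow> 'n cvec \<Rightarrow> complex" where
  "levi_form r p X Y =
     (\<Sum>j\<in>UNIV. \<Sum>k\<in>UNIV. dz j (dzbar k (\<lambda>z. complex_of_real (r z))) p * fst X $ j * cnj (fst Y $ k))"

definition levi_null_space :: "(complex^'n::finite \<Rightarrow> real) \<Rightarrow> complex^'n \<Rightarrow> 'n cvec set" where
  "levi_null_space r p = {X \<in> T10 r p. \<forall>Y\<in>T10 r p. levi_form r p X Y = 0}"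

text \<open>
  Levi pseudoconvexity, for domains with boundary of class \<open>C^2\<close>; the condition does not
  depend on the choice of the defining function.
\<close>

definition pseudoconvex :: "(complex^'n::finite) set \<Rightarrow> bool" where
  "pseudoconvex \<Omega> \<longleftrightarrow>
     (\<exists>r. defining_function 2 r \<Omega> \<and>
          (\<forall>p\<in>frontier \<Omega>. \<forall>X\<in>T10 r p. 0 \<le> Re (levi_form r p X X)))"

text \<open>
  \<open>C^k\<close> CR maps between the boundaries of two domains with defining functions \<open>r\<^sub>1\<close> and \<open>r\<^sub>2\<close>.
  Only the values of \<open>f\<close> on \<open>frontier \<Omega>\<^sub>1\<close> enter.  Vectors in \<open>T10 r\<^sub>1 p\<close> are tangent to
  the boundary, so their image is the same for every local extension \<open>F\<close> of \<open>f\<close>.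
\<close>

definition CR_map :: "nat \<Rightarrow> (complex^'n::finite) set \<Rightarrow> (complex^'n \<Rightarrow> real) \<Rightarrow>
    (complex^'n) set \<Rightarrow> (complex^'n \<Rightarrow> real) \<Rightarrow> (complex^'n \<Rightarrow> complex^'n) \<Rightarrow> bool" where
  "CR_map k \<Omega>\<^sub>1 r\<^sub>1 \<Omega>\<^sub>2 r\<^sub>2 f \<longleftrightarrow>
     f ` frontier \<Omega>\<^sub>1 \<subseteq> frontier \<Omega>\<^sub>2 \<and>
     (\<exists>U F. open U \<and> frontier \<Omega>\<^sub>1 \<subseteq> U \<and> Ck_on k F U \<and> (\<forall>p\<in>frontier \<Omega>\<^sub>1. F p = f p) \<and>
            (\<forall>p\<in>frontier \<Omega>\<^sub>1. pushforward F p ` T10 r\<^sub>1 p \<subseteq> T10 r\<^sub>2 (f p)))"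

definition CR_diffeomorphism :: "nat \<Rightarrow> (complex^'n::finite) set \<Rightarrow> (complex^'n \<Rightarrow> real) \<Rightarrow>
    (complex^'n) set \<Rightarrow> (complex^'n \<Rightarrow> real) \<Rightarrow> (complex^'n \<Rightarrow> complex^'n) \<Rightarrow> bool" where
  "CR_diffeomorphism k \<Omega>\<^sub>1 r\<^sub>1 \<Omega>\<^sub>2 r\<^sub>2 f \<longleftrightarrow>
     CR_map k \<Omega>\<^sub>1 r\<^sub>1 \<Omega>\<^sub>2 r\<^sub>2 f \<and> bij_betw f (frontier \<Omega>\<^sub>1) (frontier \<Omega>\<^sub>2) \<and>
     Ck_on_subset k (inv_into (frontier \<Omega>\<^sub>1) f) (frontier \<Omega>\<^sub>2)"


section \<open>Lie derivative, \<open>d^c\<close> and the D'Angelo 1-form\<close>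

definition lie_bracket :: "(complex^'n \<Rightarrow> 'n cvec) \<Rightarrow> (complex^'n \<Rightarrow> 'n cvec) \<Rightarrow>
    complex^'n \<Rightarrow> 'n::finite cvec" where
  "lie_bracket X Y p =
     ((\<chi> l. cvec_act (X p) (\<lambda>z. fst (Y z) $ l) p - cvec_act (Y p) (\<lambda>z. fst (X z) $ l) p),
      (\<chi> l. cvec_act (X p) (\<lambda>z. snd (Y z) $ l) p - cvec_act (Y p) (\<lambda>z. snd (X z) $ l) p))"

text \<open>
  Lie derivative of the 1-form \<open>\<omega>\<close> along the (complex) vector field \<open>T\<close>:
  \<open>(L\<^sub>T \<omega>)(X) = T(\<omega>(X)) - \<omega>([T, X])\<close>.  This is tensorial in \<open>X\<close>, so the tangent vector \<open>X\<close>
  is extended to a field with constant coefficients.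
\<close>

definition lie_derivative :: "(complex^'n \<Rightarrow> 'n cvec) \<Rightarrow> (complex^'n \<Rightarrow> 'n cvec \<Rightarrow> complex) \<Rightarrow>
    complex^'n \<Rightarrow> 'n::finite cvec \<Rightarrow> complex" where
  "lie_derivative T \<omega> p X =
     cvec_act (T p) (\<lambda>z. \<omega> z X) p - \<omega> p (lie_bracket T (\<lambda>_. X) p)"

text \<open>
  The operators \<open>\<partial>\<close> and \<open>\<partial>bar\<close> on 1-forms.  If \<open>\<omega> = \<Sum>j. A\<^sub>j dz\<^sub>j + B\<^sub>j dzbar\<^sub>j\<close>, then
  \<open>\<partial>\<omega> = \<Sum>j. \<partial>A\<^sub>j \<and> dz\<^sub>j + \<partial>B\<^sub>j \<and> dzbar\<^sub>j\<close>.  With the convention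
  \<open>(\<beta> \<and> \<gamma>)(X, Y) = \<beta>(X) \<gamma>(Y) - \<beta>(Y) \<gamma>(X)\<close> its value on \<open>(X, Y)\<close> is
  \<open>\<partial>(\<omega>(Y))(X) - \<partial>(\<omega>(X))(Y)\<close>, with \<open>X\<close> and \<open>Y\<close> extended with constant coefficients.
\<close>

definition del_form :: "(complex^'n \<Rightarrow> 'n cvec \<Rightarrow> complex) \<Rightarrow> complex^'n \<Rightarrow>
    'n::finite cvec \<Rightarrow> 'n cvec \<Rightarrow> complex" where
  "del_form \<omega> p X Y = d10 (\<lambda>z. \<omega> z Y) p X - d10 (\<lambda>z. \<omega> z X) p Y"

definition delbar_form :: "(complex^'n \<Rightarrow> 'n cvec \<Rightarrow> complex) \<Rightarrow> complex^'n \<Rightarrow>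
    'n::finite cvec \<Rightarrow> 'n cvec \<Rightarrow> complex" where
  "delbar_form \<omega> p X Y = d01 (\<lambda>z. \<omega> z Y) p X - d01 (\<lambda>z. \<omega> z X) p Y"

definition dc_form :: "(complex^'n \<Rightarrow> 'n cvec \<Rightarrow> complex) \<Rightarrow> complex^'n \<Rightarrow>
    'n::finite cvec \<Rightarrow> 'n cvec \<Rightarrow> complex" where
  "dc_form \<omega> p X Y = \<i> * (delbar_form \<omega> p X Y - del_form \<omega> p X Y)"

definition normal_field :: "(complex^'n::finite \<Rightarrow> real) \<Rightarrow> complex^'n \<Rightarrow> 'n cvec" where
  "normal_field r p =
     ((\<chi> j. dzbar j (\<lambda>z. complex_of_real (r z)) p /
             complex_of_real (\<Sum>l\<in>UNIV. (cmod (dz l (\<lambda>z. complex_of_real (r z)) p))\<^sup>2)), 0)"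

definition T_field :: "(complex^'n::finite \<Rightarrow> real) \<Rightarrow> complex^'n \<Rightarrow> 'n cvec" where
  "T_field r p = normal_field r p - cvec_cnj (normal_field r p)"

definition eta_form :: "(complex^'n::finite \<Rightarrow> real) \<Rightarrow> complex^'n \<Rightarrow> 'n cvec \<Rightarrow> complex" where
  "eta_form r p X =
     (d10 (\<lambda>z. complex_of_real (r z)) p X - d01 (\<lambda>z. complex_of_real (r z)) p X) / 2"

definition dangelo_form :: "(complex^'n::finite \<Rightarrow> real) \<Rightarrow> complex^'n \<Rightarrow> 'n cvec \<Rightarrow> complex" where
  "dangelo_form r p X = - lie_derivative (T_field r) (eta_form r) p X"

end

theory Submission
  imports Defs
begin

text \<open>
  Near the boundary \<open>\<alpha>(Lbar) = N (Lbar r)\<close>, where \<open>N\<close> is the normalized complex gradient of \<open>r\<close>,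
  and \<open>d^c\<alpha>(L, Lbar) = - 2 i Re (L (\<alpha>(Lbar)))\<close>. For a Levi null vector \<open>L\<close> at \<open>p\<close> every term
  \<open>X (Lbar r)\<close> with \<open>X\<close> of type (1,0) depends only on \<open>X r\<close>, whence
  \<open>L (\<alpha>(Lbar)) = L N (Lbar r) - (L (N r)) (N (Lbar r))\<close> at \<open>p\<close>, now with \<open>N\<close> frozen at \<open>p\<close>.
  As \<open>\<partial>bar f\<close> vanishes to second order, \<open>f\<close> transforms both expressions like a holomorphic map,
  and \<open>f\<^sub>* N\<close> differs from the normal vector of \<open>\<rho>\<close> only by a tangential vector \<open>W\<close>. The term
  in \<open>W\<close> is zero: it is the derivative along \<open>W\<close> of the Levi form on a tangential extension
  of \<open>f\<^sub>* L\<close>, a function on the boundary that is nonnegative by pseudoconvexity and has a minimum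
  at \<open>f p\<close>.
\<close>

section \<open>Functions of class \<open>C^k\<close>\<close>

text \<open>N is built from the Euclidean metric, so f need not respect it; this is how third
  derivatives of \<rho> enter. Its normalization N r = 1 is what makes f_* N and the normal vector
  at f p differ by a tangential vector. A second obstacle is that several functions describe one
  boundary: null vectors are defined by r, the form on the source by \<rho> o f, and pseudoconvexity
  supplies a further function that is only C^2. A quotient of two of them would lose a derivative.
  So they are never divided: their differentials are proportional along the boundary, and this
  relation, cross-multiplied, is differentiated in tangential directions. Finally, f is invertible
  only from boundary to boundary. That f_* is onto on (1,0) vectors has to be deduced from this; the
  regularity of \<rho> o f and the transport of null vectors both rest on it. Iterated derivatives
  are always taken along constant vectors, which commute; a moving field contributes separately
  through the derivative of its coefficients.\<close>

lemma frechet_derivative_eqI: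
  "(g has_derivative g') (at p) \<Longrightarrow> frechet_derivative g (at p) = g'"
  by (rule frechet_derivative_at[symmetric])

lemma differentiable_on_open_at:
  assumes "f differentiable_on U" "open U" "x \<in> U"
  shows "f differentiable (at x)"
  using assms at_within_open unfolding differentiable_on_def by fastforce

lemma differentiable_transform_open:
  assumes "f differentiable (at x)" "open U" "x \<in> U" "\<And>y. y \<in> U \<Longrightarrow> f y = g y"
  shows "g differentiable (at x)"
proof -
  obtain f' where "(f has_derivative f') (at x)"
    using assms(1) by (auto simp: differentiable_def)
  then show ?thesis
    by (rule differentiableI[OF has_derivative_transform_within_open[OF _ assms(2,3)]]) (rule assms(4))
qed

lemma Ck_on_imp_continuous_on: "Ck_on k f U \<Longrightarrow> continuous_on U f"
  by (cases k) (auto intro: differentiable_imp_continuous_on)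

lemma Ck_on_Suc_lower: "Ck_on (Suc k) f U \<Longrightarrow> Ck_on k f U"
proof (induction k arbitrary: f)
  case 0
  then show ?case by (auto intro: differentiable_imp_continuous_on)
next
  case (Suc k)
  from Suc.prems have "f differentiable_on U"
    and D: "\<And>v. Ck_on (Suc k) (\<lambda>x. frechet_derivative f (at x) v) U"
    by simp_all
  with Suc.IH[OF D] show ?case by simp
qed

lemma Ck_on_mono:
  assumes "Ck_on m f U" "k \<le> m"
  shows "Ck_on k f U"
  using assms(2,1)
  by (induction rule: dec_induct) (auto dest: Ck_on_Suc_lower simp del: Ck_on.simps)

lemma Ck_on_subset_domain: "Ck_on k f U \<Longrightarrow> V \<subseteq> U \<Longrightarrow> Ck_on k f V"
  by (induction k arbitrary: f) (auto intro: continuous_on_subset differentiable_on_subset)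

lemma Ck_on_cong:
  assumes "open U" "\<And>x. x \<in> U \<Longrightarrow> f x = g x"
  shows "Ck_on k f U = Ck_on k g U"
  using assms(2)
proof (induction k arbitrary: f g)
  case 0
  then show ?case by (auto cong: continuous_on_cong)
next
  case (Suc k)
  have 1: "f differentiable_on U \<longleftrightarrow> g differentiable_on U"
    using differentiable_transform_open[OF differentiable_on_open_at[OF _ assms(1)] assms(1)] Suc.prems
    by (auto intro!: differentiable_at_imp_differentiable_on)
  have 2: "frechet_derivative f (at x) v = frechet_derivative g (at x) v"
    if "f differentiable_on U" "x \<in> U" for x v
    using frechet_derivative_transform_within_open
      [OF differentiable_on_open_at[OF that(1) assms(1) that(2)] assms(1) that(2) Suc.prems] by simp
  show ?case
    using 1 2 Suc.IH[of "\<lambda>x. frechet_derivative f (at x) v" "\<lambda>x. frechet_derivative g (at x) v" for v]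
    by auto
qed

text \<open>Serves the closure rules below: an explicit derivative formula replaces
  \<open>frechet_derivative\<close>, and each induction step treats that formula.\<close>

lemma Ck_on_SucI:
  assumes "open U" "\<And>x. x \<in> U \<Longrightarrow> (f has_derivative f' x) (at x)"
    and "\<And>v. Ck_on k (\<lambda>x. f' x v) U"
  shows "Ck_on (Suc k) f U"
proof -
  have "f differentiable_on U"
    using assms(2) by (meson differentiableI differentiable_at_imp_differentiable_on)
  moreover have "Ck_on k (\<lambda>x. frechet_derivative f (at x) v) U" for v
    using assms(3)[of v]
    by (subst Ck_on_cong[OF assms(1), of _ "\<lambda>x. f' x v"]) (auto simp: frechet_derivative_eqI[OF assms(2)])
  ultimately show ?thesis by simp
qed

lemma Ck_on_SucD:
  assumes "Ck_on (Suc k) f U" "open U" "x \<in> U"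
  shows "(f has_derivative frechet_derivative f (at x)) (at x)"
  using assms differentiable_on_open_at[of f U x] frechet_derivative_works[of f "at x"] by auto

lemma Ck_on_const: "open U \<Longrightarrow> Ck_on k (\<lambda>x. c) U"
  by (induction k arbitrary: c) auto

lemma Ck_on_add:
  assumes "open U" "Ck_on k f U" "Ck_on k g U"
  shows "Ck_on k (\<lambda>x. f x + g x) U"
  using assms(2,3)
proof (induction k arbitrary: f g)
  case 0
  then show ?case by (auto intro: continuous_intros)
next
  case (Suc k)
  show ?case
    by (rule Ck_on_SucI[OF assms(1), where f' =
          "\<lambda>x v. frechet_derivative f (at x) v + frechet_derivative g (at x) v"])
       (use Suc assms(1) in \<open>auto intro!: has_derivative_add Ck_on_SucD[where k=k] Suc.IH\<close>)
qed

lemma Ck_on_sum: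
  assumes "open U" "\<And>i. i \<in> I \<Longrightarrow> Ck_on k (f i) U"
  shows "Ck_on k (\<lambda>x. \<Sum>i\<in>I. f i x) U"
  using assms(2)
  by (induction I rule: infinite_finite_induct) (auto intro: Ck_on_const Ck_on_add assms(1))

lemma Ck_on_bounded_linear:
  assumes "bounded_linear h" "open U" "Ck_on k f U"
  shows "Ck_on k (\<lambda>x. h (f x)) U"
  using assms(3)
proof (induction k arbitrary: f)
  case 0
  then show ?case
    by (auto intro: bounded_linear.continuous_on[OF assms(1)])
next
  case (Suc k)
  show ?case
    by (rule Ck_on_SucI[OF assms(2), where f' = "\<lambda>x v. h (frechet_derivative f (at x) v)"])
       (use Suc assms(2) in \<open>auto intro!: bounded_linear.has_derivative[OF assms(1)] Ck_on_SucD[where k=k] Suc.IH\<close>)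
qed

lemma Ck_on_bounded_bilinear:
  assumes "bounded_bilinear prd" "open U" "Ck_on k f U" "Ck_on k g U"
  shows "Ck_on k (\<lambda>x. prd (f x) (g x)) U"
  using assms(3,4)
proof (induction k arbitrary: f g)
  case 0
  then show ?case
    by (auto intro: bounded_bilinear.continuous_on[OF assms(1)])
next
  case (Suc k)
  have "Ck_on k f U" "Ck_on k g U"
    using Suc.prems by (auto intro: Ck_on_Suc_lower simp del: Ck_on.simps)
  then show ?case
    by (intro Ck_on_SucI[OF assms(2), where f' = "\<lambda>x v. prd (f x) (frechet_derivative g (at x) v) + prd (frechet_derivative f (at x) v) (g x)"])
       (use Suc assms(2) in \<open>auto intro!: bounded_bilinear.FDERIV[OF assms(1)] Ck_on_add Ck_on_SucD[where k=k] Suc.IH\<close>)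
qed

text \<open>The chain rule evaluates the derivative of \<open>g\<close> in a direction that moves
  with \<open>x\<close>, whereas \<open>Ck_on\<close> controls fixed directions. Expanding the
  direction in \<open>Basis\<close> gives a sum of products, and the induction hypothesis applies to
  the partial derivatives of \<open>g\<close>.\<close>

lemma Ck_on_compose:
  fixes f :: "'a::euclidean_space \<Rightarrow> 'b::euclidean_space" and g :: "'b \<Rightarrow> 'c::real_normed_vector"
  assumes "open U" "open W" "f ` U \<subseteq> W" "Ck_on k f U" "Ck_on k g W"
  shows "Ck_on k (\<lambda>x. g (f x)) U"
  using assms(4,5)
proof (induction k arbitrary: g)
  case 0
  then show ?case
    using assms(3) by (auto intro: continuous_on_compose2)
next
  case (Suc k)
  have lin: "frechet_derivative g (at y) w = (\<Sum>e\<in>Basis. (w \<bullet> e) *\<^sub>R frechet_derivative g (at y) e)"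
    if "y \<in> W" for y w
  proof -
    have "linear (frechet_derivative g (at y))"
      using Ck_on_SucD[OF Suc.prems(2) assms(2) that] has_derivative_linear by blast
    then show ?thesis
      by (subst euclidean_representation[of w, symmetric]) (simp add: linear_sum linear_scale)
  qed
  show ?case
  proof (rule Ck_on_SucI[OF assms(1)])
    fix x assume "x \<in> U"
    then have fx: "f x \<in> W" using assms(3) by blast
    show "((\<lambda>x. g (f x)) has_derivative (\<lambda>v. \<Sum>e\<in>Basis. (frechet_derivative f (at x) v \<bullet> e) *\<^sub>R frechet_derivative g (at (f x)) e)) (at x)"
      unfolding lin[OF fx, symmetric]
      by (rule has_derivative_compose[OF Ck_on_SucD[OF Suc.prems(1) assms(1) \<open>x \<in> U\<close>]
            Ck_on_SucD[OF Suc.prems(2) assms(2) fx]])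
  next
    fix v
    have "Ck_on k (\<lambda>x. frechet_derivative g (at (f x)) e) U" for e
      using Suc.IH[of "\<lambda>y. frechet_derivative g (at y) e"] Suc.prems Ck_on_Suc_lower[of k f U] by simp
    then show "Ck_on k (\<lambda>x. \<Sum>e\<in>Basis. (frechet_derivative f (at x) v \<bullet> e) *\<^sub>R frechet_derivative g (at (f x)) e) U"
      using Suc.prems(1)
      by (intro Ck_on_sum assms(1) Ck_on_bounded_bilinear[OF bounded_bilinear_scaleR]
          Ck_on_bounded_linear[OF bounded_linear_inner_left]) auto
  qed
qed

text \<open>Two applications of the mean value theorem to the second difference quotient.\<close>

lemma second_difference_mean_value:
  fixes f :: "'a::euclidean_space \<Rightarrow> real"
  assumes f: "Ck_on 2 f (ball p e)" and "0 < h" "h * (norm v + norm w) < e"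
  shows "\<exists>q. norm (q - p) \<le> h * (norm v + norm w) \<and>
     f (p + h *\<^sub>R v + h *\<^sub>R w) - f (p + h *\<^sub>R v) - f (p + h *\<^sub>R w) + f p =
       h * h * frechet_derivative (\<lambda>x. frechet_derivative f (at x) v) (at q) w"
proof -
  define g where "g = (\<lambda>x. frechet_derivative f (at x) v)"
  have Df: "(f has_derivative frechet_derivative f (at x)) (at x)"
    and Dg: "(g has_derivative frechet_derivative g (at x)) (at x)" if "x \<in> ball p e" for x
    using that f Ck_on_SucD[of 1 f "ball p e"] Ck_on_SucD[of 0 g "ball p e"]
    by (auto simp: numeral_2_eq_2 g_def)
  have nb: "norm (s *\<^sub>R v + t *\<^sub>R w) \<le> h * (norm v + norm w)" if "0 \<le> s" "s \<le> h" "0 \<le> t" "t \<le> h" for s t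
  proof -
    have "norm (s *\<^sub>R v + t *\<^sub>R w) \<le> s * norm v + t * norm w"
      using that norm_triangle_ineq[of "s *\<^sub>R v" "t *\<^sub>R w"] by simp
    also have "\<dots> \<le> h * norm v + h * norm w"
      using that by (intro add_mono mult_right_mono) auto
    finally show ?thesis by (simp add: distrib_left)
  qed
  have inb: "p + s *\<^sub>R v + t *\<^sub>R w \<in> ball p e" if "0 \<le> s" "s \<le> h" "0 \<le> t" "t \<le> h" for s t
    using le_less_trans[OF nb[OF that] assms(3)]
    by (simp only: mem_ball dist_norm norm_minus_commute[of p]) (simp add: add.assoc)
  \<comment> \<open>As a function of \<open>s\<close>, the second difference is an increment of the
    difference in direction \<open>w\<close>. The first mean value leaves an increment of
    \<open>g\<close> in direction \<open>w\<close>, which the second one resolves.\<close>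
  have "\<exists>s\<in>{0<..<h}. (f (p + h *\<^sub>R v + h *\<^sub>R w) - f (p + h *\<^sub>R v)) - (f (p + 0 *\<^sub>R v + h *\<^sub>R w) - f (p + 0 *\<^sub>R v))
      = (\<lambda>u. u * (g (p + s *\<^sub>R v + h *\<^sub>R w) - g (p + s *\<^sub>R v))) (h - 0)"
  proof (rule mvt_simple[OF \<open>0 < h\<close>, where f = "\<lambda>s. f (p + s *\<^sub>R v + h *\<^sub>R w) - f (p + s *\<^sub>R v)"])
    fix s assume s: "0 \<le> s" "s \<le> h"
    have 1: "((\<lambda>s. f (p + s *\<^sub>R v + t *\<^sub>R w)) has_derivative (\<lambda>u. u * g (p + s *\<^sub>R v + t *\<^sub>R w))) (at s)" 
      if t: "0 \<le> t" "t \<le> h" for t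
    proof -
      have "((\<lambda>s. f (p + s *\<^sub>R v + t *\<^sub>R w)) has_derivative
            (\<lambda>u. frechet_derivative f (at (p + s *\<^sub>R v + t *\<^sub>R w)) (u *\<^sub>R v))) (at s)"
        using s t by (intro has_derivative_compose[of _ "\<lambda>u. u *\<^sub>R v" _ _ f] Df inb)
           (auto intro!: derivative_eq_intros)
      moreover have "linear (frechet_derivative f (at (p + s *\<^sub>R v + t *\<^sub>R w)))"
        using s t by (intro has_derivative_linear[OF Df] inb) auto
      ultimately show ?thesis by (simp add: linear_scale g_def)
    qed
    have "((\<lambda>s. f (p + s *\<^sub>R v + h *\<^sub>R w) - f (p + s *\<^sub>R v)) has_derivative
            (\<lambda>u. u * g (p + s *\<^sub>R v + h *\<^sub>R w) - u * g (p + s *\<^sub>R v))) (at s)"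
      using has_derivative_diff[OF 1[of h] 1[of 0]] assms(2) by simp
    then show "((\<lambda>s. f (p + s *\<^sub>R v + h *\<^sub>R w) - f (p + s *\<^sub>R v)) has_derivative
            (\<lambda>u. u * (g (p + s *\<^sub>R v + h *\<^sub>R w) - g (p + s *\<^sub>R v)))) (at s within {0..h})"
      by (simp add: right_diff_distrib has_derivative_at_withinI)
  qed
  then obtain s where s: "0 < s" "s < h" and
    eq1: "f (p + h *\<^sub>R v + h *\<^sub>R w) - f (p + h *\<^sub>R v) - f (p + h *\<^sub>R w) + f p
          = h * (g (p + s *\<^sub>R v + h *\<^sub>R w) - g (p + s *\<^sub>R v))"
    by (auto simp: algebra_simps)
  have "\<exists>t\<in>{0<..<h}. g (p + s *\<^sub>R v + h *\<^sub>R w) - g (p + s *\<^sub>R v + 0 *\<^sub>R w)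
      = (\<lambda>u. frechet_derivative g (at (p + s *\<^sub>R v + t *\<^sub>R w)) (u *\<^sub>R w)) (h - 0)"
  proof (rule mvt_simple[OF \<open>0 < h\<close>, where f = "\<lambda>t. g (p + s *\<^sub>R v + t *\<^sub>R w)"])
    fix t assume t: "0 \<le> t" "t \<le> h"
    have "((\<lambda>t. g (p + s *\<^sub>R v + t *\<^sub>R w)) has_derivative
          (\<lambda>u. frechet_derivative g (at (p + s *\<^sub>R v + t *\<^sub>R w)) (u *\<^sub>R w))) (at t)"
      using s t by (intro has_derivative_compose[of _ "\<lambda>u. u *\<^sub>R w" _ _ g] Dg inb)
         (auto intro!: derivative_eq_intros)
    then show "((\<lambda>t. g (p + s *\<^sub>R v + t *\<^sub>R w)) has_derivative
          (\<lambda>u. frechet_derivative g (at (p + s *\<^sub>R v + t *\<^sub>R w)) (u *\<^sub>R w))) (at t within {0..h})"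
      by (rule has_derivative_at_withinI)
  qed
  then obtain t where t: "0 < t" "t < h" and
    eq2: "g (p + s *\<^sub>R v + h *\<^sub>R w) - g (p + s *\<^sub>R v) = frechet_derivative g (at (p + s *\<^sub>R v + t *\<^sub>R w)) (h *\<^sub>R w)"
    by auto
  have "linear (frechet_derivative g (at (p + s *\<^sub>R v + t *\<^sub>R w)))"
    using s t by (intro has_derivative_linear[OF Dg] inb) auto
  then have "f (p + h *\<^sub>R v + h *\<^sub>R w) - f (p + h *\<^sub>R v) - f (p + h *\<^sub>R w) + f p
     = h * h * frechet_derivative g (at (p + s *\<^sub>R v + t *\<^sub>R w)) w"
    unfolding eq1 eq2 by (simp add: linear_scale)
  moreover have "norm (p + s *\<^sub>R v + t *\<^sub>R w - p) \<le> h * (norm v + norm w)"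
    using nb[of s t] s t by (simp add: algebra_simps)
  ultimately show ?thesis unfolding g_def by blast
qed

text \<open>Schwarz: the second difference is symmetric in \<open>v\<close> and \<open>w\<close>, so
  division by \<open>h * h\<close> equates the two mean values, and both converge to the values at
  \<open>p\<close> by continuity of the second derivatives.\<close>

lemma frechet_derivative_symmetric_real:
  fixes f :: "'a::euclidean_space \<Rightarrow> real"
  assumes "Ck_on 2 f U" "open U" "p \<in> U"
  shows "frechet_derivative (\<lambda>x. frechet_derivative f (at x) v) (at p) w
       = frechet_derivative (\<lambda>x. frechet_derivative f (at x) w) (at p) v"
proof -
  obtain e where e: "e > 0" "ball p e \<subseteq> U"
    using assms(2,3) openE by blast
  have f: "Ck_on 2 f (ball p e)"
    using assms(1) e(2) by (rule Ck_on_subset_domain)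
  \<comment> \<open>The denominator \<open>Suc n + 1\<close> is at least 2 and \<open>c\<close>
    exceeds \<open>norm v + norm w\<close>, so already the first parallelogram lies inside the ball;
    the 1 in \<open>c\<close> covers \<open>v = w = 0\<close>.\<close>
  define c where "c = norm v + norm w + 1"
  have c: "c > 0" by (simp add: c_def add_nonneg_pos)
  define h where "h n = e / c * inverse (real (Suc n + 1))" for n
  have h0: "h n > 0" for n using e(1) c by (simp add: h_def)
  have hlt: "h n * (norm v + norm w) < e" for n
  proof -
    have "h n * (norm v + norm w) \<le> h n * c"
      using h0[of n] by (intro mult_left_mono) (auto simp: c_def)
    also have "\<dots> = e * inverse (real (Suc n + 1))" using c by (simp add: h_def)
    also have "\<dots> < e * 1" using e(1) by (intro mult_strict_left_mono) (auto simp: field_simps)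
    finally show ?thesis by simp
  qed
  have hlim: "h \<longlonglongrightarrow> 0"
    unfolding h_def
    using tendsto_mult[OF tendsto_const LIMSEQ_ignore_initial_segment[OF LIMSEQ_inverse_real_of_nat, of 1], of "e / c"]
    by (simp add: add.commute)
  have key: "\<exists>q. q \<longlonglongrightarrow> p \<and> (\<forall>n. f (p + h n *\<^sub>R v + h n *\<^sub>R w) - f (p + h n *\<^sub>R v) - f (p + h n *\<^sub>R w) + f p =
       h n * h n * frechet_derivative (\<lambda>x. frechet_derivative f (at x) v) (at (q n)) w)"
    if hl: "\<And>n. h n * (norm v + norm w) < e" for v w
  proof -
    obtain q where q: "\<And>n. norm (q n - p) \<le> h n * (norm v + norm w)"
      "\<And>n. f (p + h n *\<^sub>R v + h n *\<^sub>R w) - f (p + h n *\<^sub>R v) - f (p + h n *\<^sub>R w) + f p =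
       h n * h n * frechet_derivative (\<lambda>x. frechet_derivative f (at x) v) (at (q n)) w"
      using second_difference_mean_value[OF f h0 hl] by metis
    have "(\<lambda>n. norm (q n - p)) \<longlonglongrightarrow> 0"
      by (rule real_tendsto_sandwich[OF _ _ tendsto_const])
         (use q(1) tendsto_mult_left_zero[OF hlim, of "norm v + norm w"] in \<open>auto simp: mult.commute\<close>)
    then have "q \<longlonglongrightarrow> p"
      by (simp add: LIM_zero_iff tendsto_norm_zero_iff)
    with q(2) show ?thesis by blast
  qed
  have cont: "isCont (\<lambda>x. frechet_derivative (\<lambda>x. frechet_derivative f (at x) v) (at x) w) p" for v w
    using assms by (auto simp: numeral_2_eq_2 continuous_on_eq_continuous_at)
  obtain q where q: "q \<longlonglongrightarrow> p"
    "\<And>n. f (p + h n *\<^sub>R v + h n *\<^sub>R w) - f (p + h n *\<^sub>R v) - f (p + h n *\<^sub>R w) + f p =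
       h n * h n * frechet_derivative (\<lambda>x. frechet_derivative f (at x) v) (at (q n)) w"
    using key[of v w] hlt by blast
  obtain q' where q': "q' \<longlonglongrightarrow> p"
    "\<And>n. f (p + h n *\<^sub>R w + h n *\<^sub>R v) - f (p + h n *\<^sub>R w) - f (p + h n *\<^sub>R v) + f p =
       h n * h n * frechet_derivative (\<lambda>x. frechet_derivative f (at x) w) (at (q' n)) v"
    using key[of w v] hlt by (auto simp: add.commute)
  have "frechet_derivative (\<lambda>x. frechet_derivative f (at x) v) (at (q n)) w
      = frechet_derivative (\<lambda>x. frechet_derivative f (at x) w) (at (q' n)) v" for n
  proof -
    have "h n * h n * frechet_derivative (\<lambda>x. frechet_derivative f (at x) v) (at (q n)) w
      = h n * h n * frechet_derivative (\<lambda>x. frechet_derivative f (at x) w) (at (q' n)) v"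
      unfolding q(2)[symmetric] q'(2)[symmetric] by (simp add: algebra_simps)
    then show ?thesis using h0[of n] by simp
  qed
  then show ?thesis
    using isCont_tendsto_compose[OF cont q(1), of v w] isCont_tendsto_compose[OF cont q'(1), of w v]
      LIMSEQ_unique by auto
qed

lemma frechet_derivative_bounded_linear:
  assumes "bounded_linear h" "f differentiable (at x)"
  shows "frechet_derivative (\<lambda>x. h (f x)) (at x) v = h (frechet_derivative f (at x) v)"
  using frechet_derivative_eqI[OF bounded_linear.has_derivative[OF assms(1)
      assms(2)[unfolded frechet_derivative_works]]] by simp

lemma frechet_derivative_symmetric:
  fixes f :: "'a::euclidean_space \<Rightarrow> 'b::euclidean_space"
  assumes "Ck_on 2 f U" "open U" "p \<in> U"
  shows "frechet_derivative (\<lambda>x. frechet_derivative f (at x) v) (at p) w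
       = frechet_derivative (\<lambda>x. frechet_derivative f (at x) w) (at p) v"
proof (rule euclidean_eqI)
  fix b :: 'b
  let ?h = "\<lambda>y. y \<bullet> b"
  have bl: "bounded_linear ?h" by (rule bounded_linear_inner_left)
  have f2: "Ck_on 2 (\<lambda>x. f x \<bullet> b) U"
    by (rule Ck_on_bounded_linear[OF bl assms(2,1)])
  have d1: "f differentiable (at x)" if "x \<in> U" for x
    using assms that differentiable_on_open_at by (auto simp: numeral_2_eq_2)
  have d2: "(\<lambda>x. frechet_derivative f (at x) v) differentiable (at p)" for v
    using assms differentiable_on_open_at by (auto simp: numeral_2_eq_2)
  have *: "frechet_derivative (\<lambda>x. frechet_derivative (\<lambda>x. f x \<bullet> b) (at x) v) (at p) w
       = frechet_derivative (\<lambda>x. frechet_derivative f (at x) v) (at p) w \<bullet> b" for v w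
  proof -
    have "(\<lambda>x. frechet_derivative f (at x) v \<bullet> b) differentiable (at p)"
      using d2[of v] by simp
    then have "frechet_derivative (\<lambda>x. frechet_derivative f (at x) v \<bullet> b) (at p)
      = frechet_derivative (\<lambda>x. frechet_derivative (\<lambda>x. f x \<bullet> b) (at x) v) (at p)"
      by (rule frechet_derivative_transform_within_open[OF _ assms(2,3)])
         (simp add: frechet_derivative_bounded_linear[OF bl d1])
    then show ?thesis
      using frechet_derivative_bounded_linear[OF bl d2, of v w] by simp
  qed
  show "frechet_derivative (\<lambda>x. frechet_derivative f (at x) v) (at p) w \<bullet> b
       = frechet_derivative (\<lambda>x. frechet_derivative f (at x) w) (at p) v \<bullet> b"
    using frechet_derivative_symmetric_real[OF f2 assms(2,3), of v w] unfolding * .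
qed

section \<open>Complexified tangent vectors acting on functions\<close>

text \<open>A real tangent vector \<open>v\<close> is the pair of \<open>v\<close> and its
  conjugate. Writing \<open>X\<close> as \<open>v + \<i> w\<close> with \<open>v\<close>,
  \<open>w\<close> real and solving for them gives \<open>cvec_re\<close> and
  \<open>cvec_im\<close>.\<close>

definition cvec_re :: "'n::finite cvec \<Rightarrow> complex^'n" where
  "cvec_re X = (\<chi> j. (fst X $ j + cnj (snd X $ j)) / 2)"

definition cvec_im :: "'n::finite cvec \<Rightarrow> complex^'n" where
  "cvec_im X = (\<chi> j. (fst X $ j - cnj (snd X $ j)) / (2 * \<i>))"

lemma frechet_derivative_coords:
  fixes g :: "complex^'n::finite \<Rightarrow> complex"
  assumes "g differentiable (at p)"
  shows "frechet_derivative g (at p) v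
       = (\<Sum>j\<in>UNIV. v $ j * dz j g p) + (\<Sum>j\<in>UNIV. cnj (v $ j) * dzbar j g p)"
proof -
  let ?D = "frechet_derivative g (at p)"
  have lin: "linear ?D" by (rule linear_frechet_derivative[OF assms])
  have "v = (\<Sum>j\<in>UNIV. Re (v $ j) *\<^sub>R axis j 1 + Im (v $ j) *\<^sub>R axis j \<i>)"
    by (simp add: vec_eq_iff axis_def complex_eq_iff Re_sum Im_sum if_distrib cong: if_cong)
  then have "?D v = ?D (\<Sum>j\<in>UNIV. Re (v $ j) *\<^sub>R axis j 1 + Im (v $ j) *\<^sub>R axis j \<i>)"
    by simp
  also have "\<dots> = (\<Sum>j\<in>UNIV. Re (v $ j) *\<^sub>R ?D (axis j 1) + Im (v $ j) *\<^sub>R ?D (axis j \<i>))"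
    by (simp add: linear_sum[OF lin] linear_add[OF lin] linear_scale[OF lin])
  also have "\<dots> = (\<Sum>j\<in>UNIV. v $ j * dz j g p + cnj (v $ j) * dzbar j g p)"
    by (intro sum.cong refl) (simp add: dz_def dzbar_def complex_eq_iff field_simps)
  finally show ?thesis by (simp add: sum.distrib)
qed

text \<open>The bridge from Wirtinger derivatives to real ones: linearity, Leibniz and chain rules
  for \<open>cvec_act\<close> are read off from those for \<open>has_derivative\<close>.\<close>

lemma cvec_act_has_derivative:
  assumes "(g has_derivative g') (at p)"
  shows "cvec_act X g p = g' (cvec_re X) + \<i> * g' (cvec_im X)"
proof -
  have g: "g differentiable (at p)" using assms differentiableI by blast
  have g': "g' = frechet_derivative g (at p)" by (rule frechet_derivative_at[OF assms])
  show ?thesis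
    unfolding g' frechet_derivative_coords[OF g] cvec_act_def d10_def d01_def
    by (simp add: sum_distrib_left flip: sum.distrib)
       (intro sum.cong refl, simp add: cvec_re_def cvec_im_def field_simps)
qed

lemma cvec_act_frechet:
  "g differentiable (at p) \<Longrightarrow> cvec_act X g p =
     frechet_derivative g (at p) (cvec_re X) + \<i> * frechet_derivative g (at p) (cvec_im X)"
  by (rule cvec_act_has_derivative) (simp add: frechet_derivative_works[symmetric])

lemma dz_eq_cvec_act: "dz j g p = cvec_act (axis j 1, 0) g p"
  by (simp add: cvec_act_def d10_def d01_def axis_def if_distrib if_distribR sum.If_cases cong: if_cong)

lemma dzbar_eq_cvec_act: "dzbar j g p = cvec_act (0, axis j 1) g p"
  by (simp add: cvec_act_def d10_def d01_def axis_def if_distrib if_distribR sum.If_cases cong: if_cong)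

lemma cvec_act_expand:
  "cvec_act X g p = (\<Sum>j\<in>UNIV. fst X $ j * dz j g p) + (\<Sum>j\<in>UNIV. snd X $ j * dzbar j g p)"
  by (simp add: cvec_act_def d10_def d01_def)

lemma cvec_act_plus_vec: "cvec_act (X + Y) g p = cvec_act X g p + cvec_act Y g p"
  by (simp add: cvec_act_expand distrib_right sum.distrib)

lemma cvec_act_diff_vec: "cvec_act (X - Y) g p = cvec_act X g p - cvec_act Y g p"
  by (simp add: cvec_act_expand left_diff_distrib sum_subtractf)

lemma cvec_act_minus_vec: "cvec_act (- X) g p = - cvec_act X g p"
  by (simp add: cvec_act_expand sum_negf)

lemma cvec_act_zero_vec [simp]: "cvec_act 0 g p = 0" "cvec_act (0, 0) g p = 0"
  by (simp_all add: cvec_act_expand)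

definition cvec_scale :: "complex \<Rightarrow> 'n::finite cvec \<Rightarrow> 'n cvec" where
  "cvec_scale c X = (c *s fst X, c *s snd X)"

lemma cvec_act_scale_vec: "cvec_act (cvec_scale c X) g p = c * cvec_act X g p"
  by (simp add: cvec_act_expand cvec_scale_def distrib_left sum_distrib_left mult.assoc)

lemma cvec_act_cong:
  assumes "open U" "p \<in> U" "\<And>z. z \<in> U \<Longrightarrow> g z = h z"
  shows "cvec_act X g p = cvec_act X h p"
proof -
  \<comment> \<open>Both functions have the same derivatives at \<open>p\<close>, possibly none, so
    the choice operator inside \<open>frechet_derivative\<close> returns the same value even without
    differentiability.\<close>
  have "(g has_derivative g') (at p) \<longleftrightarrow> (h has_derivative g') (at p)" for g'
    using has_derivative_transform_within_open[of g g' p UNIV U h]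
      has_derivative_transform_within_open[of h g' p UNIV U g] assms by auto
  then have "frechet_derivative g (at p) = frechet_derivative h (at p)"
    by (simp add: frechet_derivative_def)
  then show ?thesis by (simp add: cvec_act_expand dz_def dzbar_def)
qed

lemma cvec_act_const [simp]: "cvec_act X (\<lambda>z. c) p = 0"
  by (simp add: cvec_act_expand dz_def dzbar_def)

lemma cvec_act_add:
  assumes "g differentiable (at p)" "h differentiable (at p)"
  shows "cvec_act X (\<lambda>z. g z + h z) p = cvec_act X g p + cvec_act X h p"
  using assms
  by (simp add: frechet_derivative_works cvec_act_frechet
      cvec_act_has_derivative[OF has_derivative_add] algebra_simps)

lemma cvec_act_diff:
  assumes "g differentiable (at p)" "h differentiable (at p)"
  shows "cvec_act X (\<lambda>z. g z - h z) p = cvec_act X g p - cvec_act X h p"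
  using assms
  by (simp add: frechet_derivative_works cvec_act_frechet
      cvec_act_has_derivative[OF has_derivative_diff] algebra_simps)

lemma cvec_act_mult:
  assumes "g differentiable (at p)" "h differentiable (at p)"
  shows "cvec_act X (\<lambda>z. g z * h z) p = cvec_act X g p * h p + g p * cvec_act X h p"
  using assms
  by (simp add: frechet_derivative_works cvec_act_frechet
      cvec_act_has_derivative[OF has_derivative_mult] algebra_simps)

lemma cvec_act_cmult:
  assumes "g differentiable (at p)"
  shows "cvec_act X (\<lambda>z. c * g z) p = c * cvec_act X g p"
  using cvec_act_mult[OF differentiable_const assms] by simp

lemma cvec_act_sum:
  assumes "\<And>i. i \<in> I \<Longrightarrow> g i differentiable (at p)"
  shows "cvec_act X (\<lambda>z. \<Sum>i\<in>I. g i z) p = (\<Sum>i\<in>I. cvec_act X (g i) p)"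
  using assms
proof (induction I rule: infinite_finite_induct)
  case (insert i I)
  then have "(\<lambda>z. \<Sum>i\<in>I. g i z) differentiable (at p)"
    by (intro differentiable_sum) auto
  with insert show ?case by (simp add: cvec_act_add)
qed auto

lemma cvec_cnj_cnj [simp]: "cvec_cnj (cvec_cnj X) = X"
  by (simp add: cvec_cnj_def vec_eq_iff prod_eq_iff)

lemma cvec_act_cnj:
  assumes "g differentiable (at p)"
  shows "cvec_act X (\<lambda>z. cnj (g z)) p = cnj (cvec_act (cvec_cnj X) g p)"
proof -
  have "cvec_re (cvec_cnj X) = cvec_re X" "cvec_im (cvec_cnj X) = - cvec_im X"
    by (simp_all add: cvec_re_def cvec_im_def cvec_cnj_def vec_eq_iff add.commute field_simps)
  moreover have "linear (frechet_derivative g (at p))" by (rule linear_frechet_derivative[OF assms])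
  moreover have "((\<lambda>z. cnj (g z)) has_derivative (\<lambda>v. cnj (frechet_derivative g (at p) v))) (at p)"
    using assms by (intro has_derivative_cnj) (simp add: frechet_derivative_works)
  ultimately show ?thesis
    using assms by (simp add: cvec_act_frechet cvec_act_has_derivative linear_neg)
qed

lemma differentiable_cnj: "g differentiable (at p) \<Longrightarrow> (\<lambda>z. cnj (g z)) differentiable (at p)"
  unfolding differentiable_def by (blast intro: has_derivative_cnj)

lemma frechet_derivative_nth:
  assumes "f differentiable (at p)"
  shows "((\<lambda>z. f z $ l) has_derivative (\<lambda>v. frechet_derivative f (at p) v $ l)) (at p)"
  using assms bounded_linear.has_derivative[OF bounded_linear_vec_nth]
  by (simp add: frechet_derivative_works)

text \<open>The pushforward is the complex-linear extension of the real derivative, hence acts on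
  real and imaginary parts separately; this reduces the chain rule to the real one.\<close>

lemma pushforward_parts:
  assumes "f differentiable (at p)"
  shows "cvec_re (pushforward f p X) = frechet_derivative f (at p) (cvec_re X)"
    and "cvec_im (pushforward f p X) = frechet_derivative f (at p) (cvec_im X)"
  using cvec_act_has_derivative[OF frechet_derivative_nth[OF assms]]
    cvec_act_has_derivative[OF has_derivative_cnj[OF frechet_derivative_nth[OF assms]]]
  by (simp_all add: cvec_re_def cvec_im_def pushforward_def vec_eq_iff field_simps)

lemma cvec_act_compose:
  assumes "f differentiable (at p)" "g differentiable (at (f p))"
  shows "cvec_act X (\<lambda>z. g (f z)) p = cvec_act (pushforward f p X) g (f p)"
proof -
  have "((\<lambda>z. g (f z)) has_derivative
      (\<lambda>v. frechet_derivative g (at (f p)) (frechet_derivative f (at p) v))) (at p)"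
    by (rule has_derivative_compose[OF assms[unfolded frechet_derivative_works]])
  then show ?thesis
    by (simp add: cvec_act_has_derivative cvec_act_frechet[OF assms(2)] pushforward_parts[OF assms(1)])
qed

lemma Ck_on_cvec_act:
  assumes "Ck_on (Suc k) g U" "open U"
  shows "Ck_on k (cvec_act X g) U"
proof -
  have "Ck_on k (\<lambda>z. frechet_derivative g (at z) (cvec_re X) + \<i> * frechet_derivative g (at z) (cvec_im X)) U"
    using assms by (intro Ck_on_add Ck_on_bounded_linear[OF bounded_linear_mult_right]) auto
  moreover have "cvec_act X g z = frechet_derivative g (at z) (cvec_re X) + \<i> * frechet_derivative g (at z) (cvec_im X)"
    if "z \<in> U" for z
    using cvec_act_frechet[OF differentiableI[OF Ck_on_SucD[OF assms that]]] .
  ultimately show ?thesis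
    by (subst Ck_on_cong[OF assms(2)]) auto
qed

lemma Ck_on_imp_differentiable:
  assumes "Ck_on k g U" "open U" "p \<in> U" "1 \<le> k"
  shows "g differentiable (at p)"
  using Ck_on_SucD[of 0 g U p] Ck_on_mono[OF assms(1), of 1] assms differentiableI by fastforce

lemma cvec_act_differentiable:
  assumes "Ck_on k g U" "open U" "p \<in> U" "2 \<le> k"
  shows "cvec_act X g differentiable (at p)"
  using Ck_on_imp_differentiable[OF Ck_on_cvec_act[of 1 g U X] assms(2,3)]
    Ck_on_mono[OF assms(1), of "Suc 1"] assms(2,4) by simp

lemma cvec_act_act_differentiable:
  assumes "Ck_on k g U" "open U" "p \<in> U" "3 \<le> k"
  shows "cvec_act X (cvec_act Y g) differentiable (at p)"
  using cvec_act_differentiable[OF Ck_on_cvec_act[of 2 g U Y] assms(2,3)]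
    Ck_on_mono[OF assms(1), of "Suc 2"] assms(2,4) by simp

text \<open>Constant vectors have no bracket; what remains is the symmetry of the real Hessian,
  extended complex-bilinearly.\<close>

lemma cvec_act_commute:
  assumes "Ck_on k g U" "2 \<le> k" "open U" "p \<in> U"
  shows "cvec_act X (cvec_act Y g) p = cvec_act Y (cvec_act X g) p"
proof -
  have C2: "Ck_on 2 g U" using assms(1,2) by (rule Ck_on_mono)
  let ?H = "\<lambda>v w. frechet_derivative (\<lambda>z. frechet_derivative g (at z) v) (at p) w"
  have *: "cvec_act X (cvec_act Y g) p = (?H (cvec_re Y) (cvec_re X) + \<i> * ?H (cvec_im Y) (cvec_re X)) +
     \<i> * (?H (cvec_re Y) (cvec_im X) + \<i> * ?H (cvec_im Y) (cvec_im X))" for X Y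
  proof -
    have "cvec_act X (cvec_act Y g) p = cvec_act X (\<lambda>z. frechet_derivative g (at z) (cvec_re Y) + \<i> * frechet_derivative g (at z) (cvec_im Y)) p"
      using assms(3,4)
      by (rule cvec_act_cong) (auto intro!: cvec_act_frechet Ck_on_imp_differentiable[OF C2 assms(3)])
    moreover have "((\<lambda>z. frechet_derivative g (at z) v) has_derivative ?H v) (at p)" for v
      using C2 by (intro Ck_on_SucD[of 0 _ U] assms(3,4)) (simp add: numeral_2_eq_2)
    note D = this
    ultimately show ?thesis
      using cvec_act_has_derivative[OF has_derivative_add[OF D has_derivative_mult_right[OF D]]] by simp
  qed
  have "?H v w = ?H w v" for v w
    by (rule frechet_derivative_symmetric[OF C2 assms(3,4)])
  then show ?thesis unfolding * by (simp add: algebra_simps)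
qed

section \<open>Fields with variable coefficients\<close>

text \<open>The flat connection of the ambient space: coefficients are differentiated, the
  coordinate frame is parallel.\<close>

definition cvec_deriv :: "'n::finite cvec \<Rightarrow> (complex^'n \<Rightarrow> 'n cvec) \<Rightarrow> complex^'n \<Rightarrow> 'n cvec" where
  "cvec_deriv Z A p =
     ((\<chi> l. cvec_act Z (\<lambda>z. fst (A z) $ l) p), (\<chi> l. cvec_act Z (\<lambda>z. snd (A z) $ l) p))"

definition cvec_differentiable :: "(complex^'n \<Rightarrow> 'n cvec) \<Rightarrow> complex^'n \<Rightarrow> bool" where
  "cvec_differentiable A p \<longleftrightarrow>
     (\<forall>l. (\<lambda>z. fst (A z) $ l) differentiable (at p) \<and> (\<lambda>z. snd (A z) $ l) differentiable (at p))"

lemma dz_dzbar_Ck_on: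
  assumes "Ck_on (Suc k) g U" "open U"
  shows "Ck_on k (dz j g) U" "Ck_on k (dzbar j g) U"
  using Ck_on_cvec_act[OF assms]
  by (simp_all add: dz_eq_cvec_act[abs_def] dzbar_eq_cvec_act[abs_def])

lemma dz_dzbar_differentiable:
  assumes "Ck_on k g U" "open U" "p \<in> U" "2 \<le> k"
  shows "dz j g differentiable (at p)" "dzbar j g differentiable (at p)"
  using cvec_act_differentiable[OF assms]
  by (simp_all add: dz_eq_cvec_act[abs_def] dzbar_eq_cvec_act[abs_def])

lemma cvec_act_act_expand:
  assumes "Ck_on k g W" "open W" "w \<in> W" "2 \<le> k"
  shows "cvec_act B (cvec_act A g) w =
     (\<Sum>l\<in>UNIV. fst A $ l * cvec_act B (dz l g) w) + (\<Sum>l\<in>UNIV. snd A $ l * cvec_act B (dzbar l g) w)"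
proof -
  have "cvec_act A g = (\<lambda>z. (\<Sum>j\<in>UNIV. fst A $ j * dz j g z) + (\<Sum>j\<in>UNIV. snd A $ j * dzbar j g z))"
    by (simp add: cvec_act_expand fun_eq_iff)
  then show ?thesis
    using dz_dzbar_differentiable[OF assms]
    by (simp add: cvec_act_add cvec_act_sum cvec_act_cmult)
qed

text \<open>Product rule in the coefficients of \<open>A\<close> together with the chain rule
  through \<open>f\<close>. A general \<open>f\<close> serves the higher chain rules, where
  \<open>A\<close> is a pushforward; the identity gives the rule for fields on one space.\<close>

lemma cvec_act_variable:
  assumes "Ck_on k g W" "open W" "f p \<in> W" "2 \<le> k" "f differentiable (at p)" "cvec_differentiable A p"
  shows "(\<lambda>z. cvec_act (A z) g (f z)) differentiable (at p)" (is ?th1)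
    and "cvec_act Z (\<lambda>z. cvec_act (A z) g (f z)) p =
     cvec_act (cvec_deriv Z A p) g (f p) + cvec_act (pushforward f p Z) (cvec_act (A p) g) (f p)" (is ?th2)
proof -
  have d: "dz j g differentiable (at (f p))" "dzbar j g differentiable (at (f p))" for j
    using dz_dzbar_differentiable[OF assms(1-4)] .
  have df: "(\<lambda>z. dz j g (f z)) differentiable (at p)" "(\<lambda>z. dzbar j g (f z)) differentiable (at p)" for j
    by (rule differentiable_compose[of "dz j g" f, OF d(1) assms(5)],
        rule differentiable_compose[of "dzbar j g" f, OF d(2) assms(5)])
  have A: "(\<lambda>z. fst (A z) $ l) differentiable (at p)" "(\<lambda>z. snd (A z) $ l) differentiable (at p)" for l
    using assms(6) by (auto simp: cvec_differentiable_def)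
  show ?th1
    using A df by (simp add: cvec_act_expand)
  show ?th2
    unfolding cvec_act_act_expand[OF assms(1-4)]
    using A d df assms(5)
    by (simp add: cvec_act_expand[of _ g] cvec_act_add cvec_act_sum cvec_act_mult cvec_act_compose
        cvec_deriv_def sum.distrib)
qed

lemma cvec_act_variable2:
  assumes "Ck_on k g W" "open W" "3 \<le> k" "open U" "p \<in> U" "f ` U \<subseteq> W" 
    and "f differentiable (at p)" "cvec_differentiable A p" "cvec_differentiable B p"
  shows "cvec_act Z (\<lambda>z. cvec_act (B z) (cvec_act (A z) g) (f z)) p =
     cvec_act (cvec_deriv Z B p) (cvec_act (A p) g) (f p) +
     cvec_act (B p) (cvec_act (cvec_deriv Z A p) g) (f p) +
     cvec_act (pushforward f p Z) (cvec_act (B p) (cvec_act (A p) g)) (f p)"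
proof -
  have C3: "Ck_on (Suc 2) g W" using Ck_on_mono[OF assms(1)] assms(3) by simp
  note C2 = dz_dzbar_Ck_on[OF C3 assms(2)]
  have C2g: "Ck_on 2 g W" using Ck_on_mono[OF assms(1)] assms(3) by simp
  have fp: "f p \<in> W" using assms(5,6) by blast
  have A: "(\<lambda>z. fst (A z) $ l) differentiable (at p)" "(\<lambda>z. snd (A z) $ l) differentiable (at p)" for l
    using assms(8) by (auto simp: cvec_differentiable_def)
  \<comment> \<open>Only the inner field is expanded in coordinates. The outer one then acts on the
    fixed functions \<open>dz l g\<close> and \<open>dzbar l g\<close>, where the first-order rule
    applies.\<close>
  have "cvec_act Z (\<lambda>z. cvec_act (B z) (cvec_act (A z) g) (f z)) p =
     cvec_act Z (\<lambda>z. (\<Sum>l\<in>UNIV. fst (A z) $ l * cvec_act (B z) (dz l g) (f z)) +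
                 (\<Sum>l\<in>UNIV. snd (A z) $ l * cvec_act (B z) (dzbar l g) (f z))) p"
    using assms(4,5)
    by (rule cvec_act_cong) (use assms(6) in \<open>auto intro!: cvec_act_act_expand[OF C2g assms(2)]\<close>)
  also have "\<dots> = cvec_act (cvec_deriv Z B p) (cvec_act (A p) g) (f p) +
     cvec_act (B p) (cvec_act (cvec_deriv Z A p) g) (f p) +
     ((\<Sum>l\<in>UNIV. fst (A p) $ l * cvec_act (pushforward f p Z) (cvec_act (B p) (dz l g)) (f p)) +
      (\<Sum>l\<in>UNIV. snd (A p) $ l * cvec_act (pushforward f p Z) (cvec_act (B p) (dzbar l g)) (f p)))"
    unfolding cvec_act_act_expand[OF C2g assms(2) fp order_refl]
    using A cvec_act_variable[OF C2(1) assms(2) fp order_refl assms(7,9)]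
      cvec_act_variable[OF C2(2) assms(2) fp order_refl assms(7,9)]
    by (simp add: cvec_act_add cvec_act_sum cvec_act_mult cvec_deriv_def sum.distrib algebra_simps)
  also have "(\<Sum>l\<in>UNIV. fst (A p) $ l * cvec_act (pushforward f p Z) (cvec_act (B p) (dz l g)) (f p)) +
      (\<Sum>l\<in>UNIV. snd (A p) $ l * cvec_act (pushforward f p Z) (cvec_act (B p) (dzbar l g)) (f p)) =
     cvec_act (pushforward f p Z) (cvec_act (B p) (cvec_act (A p) g)) (f p)"
  proof -
    have "cvec_act (pushforward f p Z) (cvec_act (B p) (cvec_act (A p) g)) (f p) =
       cvec_act (pushforward f p Z) (\<lambda>w. (\<Sum>l\<in>UNIV. fst (A p) $ l * cvec_act (B p) (dz l g) w) +
         (\<Sum>l\<in>UNIV. snd (A p) $ l * cvec_act (B p) (dzbar l g) w)) (f p)"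
      using assms(2) fp
      by (rule cvec_act_cong) (auto intro!: cvec_act_act_expand[OF C2g assms(2)])
    then show ?thesis
      using cvec_act_differentiable[OF C2(1) assms(2) fp] cvec_act_differentiable[OF C2(2) assms(2) fp]
      by (simp add: cvec_act_add cvec_act_sum cvec_act_cmult)
  qed
  finally show ?thesis .
qed

section \<open>Chain rules\<close>

lemma pushforward_ident [simp]: "pushforward (\<lambda>z. z) p X = X"
proof -
  have "cvec_re (pushforward (\<lambda>z. z) p X) = cvec_re X" "cvec_im (pushforward (\<lambda>z. z) p X) = cvec_im X"
    by (simp_all add: pushforward_parts)
  moreover have "fst Y $ j = cvec_re Y $ j + \<i> * cvec_im Y $ j"
      "snd Y $ j = cnj (cvec_re Y $ j) + \<i> * cnj (cvec_im Y $ j)" for Y :: "'a cvec" and j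
    by (simp_all add: cvec_re_def cvec_im_def field_simps)
  ultimately show ?thesis by (simp add: prod_eq_iff vec_eq_iff)
qed

lemma cvec_act_variable_ident:
  assumes "Ck_on k g W" "open W" "p \<in> W" "2 \<le> k" "cvec_differentiable A p"
  shows "(\<lambda>z. cvec_act (A z) g z) differentiable (at p)"
    and "cvec_act Z (\<lambda>z. cvec_act (A z) g z) p =
     cvec_act (cvec_deriv Z A p) g p + cvec_act Z (cvec_act (A p) g) p"
  using cvec_act_variable[OF assms(1,2) _ assms(4), of "\<lambda>z. z"] assms(3,5) by simp_all

lemma cvec_cnj_simps [simp]:
  "fst (cvec_cnj X) = (\<chi> j. cnj (snd X $ j))" "snd (cvec_cnj X) = (\<chi> j. cnj (fst X $ j))"
  by (simp_all add: cvec_cnj_def)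

lemma vec_zero_lambda [simp]: "(\<chi> j. 0) = (0::complex^'n::finite)"
  by (simp add: vec_eq_iff)

lemma cvec_act_cnj':
  assumes "Ck_on k g U" "1 \<le> k" "open U" "p \<in> U"
  shows "cvec_act X (\<lambda>z. cnj (g z)) p = cnj (cvec_act (cvec_cnj X) g p)"
  using cvec_act_cnj[OF Ck_on_imp_differentiable[OF assms(1,3,4,2)]] .

lemma cvec_act2_cnj:
  assumes "Ck_on k g U" "2 \<le> k" "open U" "p \<in> U"
  shows "cvec_act X (cvec_act Y (\<lambda>z. cnj (g z))) p = cnj (cvec_act (cvec_cnj X) (cvec_act (cvec_cnj Y) g) p)"
proof -
  have "cvec_act X (cvec_act Y (\<lambda>z. cnj (g z))) p = cvec_act X (\<lambda>z. cnj (cvec_act (cvec_cnj Y) g z)) p"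
    using assms(2) by (intro cvec_act_cong[OF assms(3,4)] cvec_act_cnj'[OF assms(1) _ assms(3)]) auto
  also have "\<dots> = cnj (cvec_act (cvec_cnj X) (cvec_act (cvec_cnj Y) g) p)"
    by (rule cvec_act_cnj[OF cvec_act_differentiable[OF assms(1,3,4,2)]])
  finally show ?thesis .
qed

lemma cvec_act3_cnj:
  assumes "Ck_on k g U" "3 \<le> k" "open U" "p \<in> U"
  shows "cvec_act Z (cvec_act X (cvec_act Y (\<lambda>z. cnj (g z)))) p
       = cnj (cvec_act (cvec_cnj Z) (cvec_act (cvec_cnj X) (cvec_act (cvec_cnj Y) g)) p)"
proof -
  have "cvec_act Z (cvec_act X (cvec_act Y (\<lambda>z. cnj (g z)))) p
      = cvec_act Z (\<lambda>z. cnj (cvec_act (cvec_cnj X) (cvec_act (cvec_cnj Y) g) z)) p"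
    using assms(2) by (intro cvec_act_cong[OF assms(3,4)] cvec_act2_cnj[OF assms(1) _ assms(3)]) auto
  also have "\<dots> = cnj (cvec_act (cvec_cnj Z) (cvec_act (cvec_cnj X) (cvec_act (cvec_cnj Y) g)) p)"
    by (rule cvec_act_cnj[OF cvec_act_act_differentiable[OF assms(1,3,4,2)]])
  finally show ?thesis .
qed

lemma Ck_on_nth: "open U \<Longrightarrow> Ck_on k f U \<Longrightarrow> Ck_on k (\<lambda>z. f z $ l) U"
  by (rule Ck_on_bounded_linear[OF bounded_linear_vec_nth])

lemma Ck_on_cnj: "open U \<Longrightarrow> Ck_on k f U \<Longrightarrow> Ck_on k (\<lambda>z. cnj (f z)) U"
  by (rule Ck_on_bounded_linear[OF bounded_linear_cnj])

lemma pushforward_differentiable: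
  assumes "Ck_on k f U" "2 \<le> k" "open U" "p \<in> U"
  shows "cvec_differentiable (\<lambda>z. pushforward f z Y) p"
  using cvec_act_differentiable[OF Ck_on_nth[OF assms(3,1)] assms(3,4,2)]
    cvec_act_differentiable[OF Ck_on_cnj[OF assms(3) Ck_on_nth[OF assms(3,1)]] assms(3,4,2)]
  by (simp add: cvec_differentiable_def pushforward_def)

text \<open>The vector-valued Hessian of \<open>f\<close>, which is the correction term of the
  second-order chain rule.\<close>

definition pushforward2 :: "(complex^'n \<Rightarrow> complex^'n) \<Rightarrow> complex^'n \<Rightarrow> 'n::finite cvec \<Rightarrow> 'n cvec \<Rightarrow> 'n cvec" where
  "pushforward2 f p X Y = cvec_deriv X (\<lambda>z. pushforward f z Y) p"

lemma pushforward2_eq: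
  "pushforward2 f p X Y = ((\<chi> l. cvec_act X (cvec_act Y (\<lambda>z. f z $ l)) p),
     (\<chi> l. cvec_act X (cvec_act Y (\<lambda>z. cnj (f z $ l))) p))"
  by (simp add: pushforward2_def cvec_deriv_def pushforward_def)

lemma pushforward2_differentiable:
  assumes "Ck_on k f U" "3 \<le> k" "open U" "p \<in> U"
  shows "cvec_differentiable (\<lambda>z. pushforward2 f z X Y) p"
  using cvec_act_act_differentiable[OF Ck_on_nth[OF assms(3,1)] assms(3,4,2)]
    cvec_act_act_differentiable[OF Ck_on_cnj[OF assms(3) Ck_on_nth[OF assms(3,1)]] assms(3,4,2)]
  by (simp add: cvec_differentiable_def pushforward2_eq)

lemma cvec_act_compose2:
  assumes "Ck_on k f U" "Ck_on k g W" "2 \<le> k" "open U" "open W" "f ` U \<subseteq> W" "p \<in> U"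
  shows "cvec_act X (cvec_act Y (\<lambda>z. g (f z))) p =
    cvec_act (pushforward2 f p X Y) g (f p) +
    cvec_act (pushforward f p X) (cvec_act (pushforward f p Y) g) (f p)"
proof -
  have "cvec_act X (cvec_act Y (\<lambda>z. g (f z))) p = cvec_act X (\<lambda>z. cvec_act (pushforward f z Y) g (f z)) p"
    using assms
    by (intro cvec_act_cong[OF assms(4,7)] cvec_act_compose Ck_on_imp_differentiable[of k _ U]
        Ck_on_imp_differentiable[of k _ W]) auto
  also have "\<dots> = cvec_act (pushforward2 f p X Y) g (f p) +
    cvec_act (pushforward f p X) (cvec_act (pushforward f p Y) g) (f p)"
    unfolding pushforward2_def
    using assms by (intro cvec_act_variable(2)[OF assms(2)] pushforward_differentiable[of k _ U]
        Ck_on_imp_differentiable[of k _ U]) auto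
  finally show ?thesis .
qed

text \<open>Faa di Bruno of order three: one term for each of the five partitions of the directions
  \<open>Z\<close>, \<open>X\<close>, \<open>Y\<close>.\<close>

lemma cvec_act_compose3:
  assumes "Ck_on k f U" "Ck_on k g W" "3 \<le> k" "open U" "open W" "f ` U \<subseteq> W" "p \<in> U"
  shows "cvec_act Z (cvec_act X (cvec_act Y (\<lambda>z. g (f z)))) p =
    cvec_act (cvec_deriv Z (\<lambda>z. pushforward2 f z X Y) p) g (f p) +
    cvec_act (pushforward f p Z) (cvec_act (pushforward2 f p X Y) g) (f p) +
    cvec_act (pushforward2 f p Z X) (cvec_act (pushforward f p Y) g) (f p) +
    cvec_act (pushforward f p X) (cvec_act (pushforward2 f p Z Y) g) (f p) +
    cvec_act (pushforward f p Z) (cvec_act (pushforward f p X) (cvec_act (pushforward f p Y) g)) (f p)"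
proof -
  let ?G1 = "\<lambda>z. cvec_act (pushforward2 f z X Y) g (f z)"
  let ?G2 = "\<lambda>z. cvec_act (pushforward f z X) (cvec_act (pushforward f z Y) g) (f z)"
  have k2: "2 \<le> k" using assms(3) by simp
  have df: "f differentiable (at p)" using assms by (intro Ck_on_imp_differentiable[of k _ U]) auto
  have fp: "f p \<in> W" using assms(6,7) by blast
  have eq: "cvec_act Z (cvec_act X (cvec_act Y (\<lambda>z. g (f z)))) p = cvec_act Z (\<lambda>z. ?G1 z + ?G2 z) p"
    by (intro cvec_act_cong[OF assms(4,7)] cvec_act_compose2[OF assms(1,2) k2 assms(4-6)])
  \<comment> \<open>\<open>?G2\<close> is shown differentiable by subtraction:
    \<open>?G1 + ?G2\<close> is near \<open>p\<close> a second derivative of the composite, and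
    \<open>?G1\<close> is covered by the first-order rule.\<close>
  have "Ck_on k (\<lambda>z. g (f z)) U"
    by (rule Ck_on_compose[OF assms(4-6,1,2)])
  then have "(\<lambda>z. ?G1 z + ?G2 z) differentiable (at p)"
    using cvec_act_compose2[OF assms(1,2) k2 assms(4-6)]
    by (intro differentiable_transform_open[OF cvec_act_act_differentiable[OF _ assms(4,7,3)] assms(4,7)])
  moreover have d1: "?G1 differentiable (at p)"
    by (rule cvec_act_variable(1)[OF assms(2,5) fp k2 df pushforward2_differentiable[OF assms(1,3,4,7)]])
  ultimately have d2: "?G2 differentiable (at p)"
    using differentiable_diff[of "\<lambda>z. ?G1 z + ?G2 z" "at p" ?G1] by simp
  show ?thesis
    unfolding eq cvec_act_add[OF d1 d2]
      cvec_act_variable(2)[OF assms(2,5) fp k2 df pushforward2_differentiable[OF assms(1,3,4,7)]]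
      cvec_act_variable2[OF assms(2,5,3,4,7,6) df pushforward_differentiable[OF assms(1) k2 assms(4,7)]
          pushforward_differentiable[OF assms(1) k2 assms(4,7)]]
    by (simp flip: pushforward2_def)
qed

text \<open>A map whose \<open>\<partial>bar\<close>-derivatives vanish to second order at \<open>p\<close> obeys there, up to
  order three, the chain rule of a holomorphic map.\<close>

locale almost_holomorphic_at =
  fixes f :: "complex^'n::finite \<Rightarrow> complex^'n" and p :: "complex^'n" and U :: "(complex^'n) set"
  assumes open_U: "open U" and p_in_U: "p \<in> U" and f_C3: "Ck_on 3 f U"
    and dbar0: "\<And>Y l. fst Y = 0 \<Longrightarrow> cvec_act Y (\<lambda>z. f z $ l) p = 0"
    and dbar1: "\<And>X Y l. fst Y = 0 \<Longrightarrow> cvec_act X (cvec_act Y (\<lambda>z. f z $ l)) p = 0"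
    and dbar2: "\<And>X Y Z l. fst Z = 0 \<Longrightarrow> cvec_act X (cvec_act Y (cvec_act Z (\<lambda>z. f z $ l))) p = 0"
begin

lemma f_nth_C3: "Ck_on 3 (\<lambda>z. f z $ l) U"
  by (rule Ck_on_nth[OF open_U f_C3])

lemma f_differentiable: "f differentiable (at p)"
  using Ck_on_imp_differentiable[OF f_C3 open_U p_in_U] by simp

lemma dbar1': "fst X = 0 \<Longrightarrow> cvec_act X (cvec_act Y (\<lambda>z. f z $ l)) p = 0"
  using dbar1[of X Y l] cvec_act_commute[OF f_nth_C3 _ open_U p_in_U, of X Y l] by simp

text \<open>The two inner derivatives commute on all of \<open>U\<close>, so their exchange may be
  differentiated once more.\<close>

lemma dbar2':
  assumes "fst Y = 0"
  shows "cvec_act X (cvec_act Y (cvec_act Z (\<lambda>z. f z $ l))) p = 0"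
proof -
  have "cvec_act X (cvec_act Y (cvec_act Z (\<lambda>z. f z $ l))) p
     = cvec_act X (cvec_act Z (cvec_act Y (\<lambda>z. f z $ l))) p"
    by (intro cvec_act_cong[OF open_U p_in_U] cvec_act_commute[OF f_nth_C3 _ open_U]) auto
  then show ?thesis using dbar2[OF assms] by simp
qed

lemmas f_nth_cnj =
  cvec_act_cnj'[OF f_nth_C3 _ open_U p_in_U] cvec_act2_cnj[OF f_nth_C3 _ open_U p_in_U]
  cvec_act3_cnj[OF f_nth_C3 _ open_U p_in_U]

lemma snd_pushforward: "snd X = 0 \<Longrightarrow> snd (pushforward f p X) = 0"
  using dbar0[of "cvec_cnj X"] by (simp add: pushforward_def f_nth_cnj)

lemma pushforward_cnj: "pushforward f p (cvec_cnj X) = cvec_cnj (pushforward f p X)"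
  by (simp add: pushforward_def f_nth_cnj prod_eq_iff)

text \<open>Either component contains a derivative of type (0,1) of \<open>f\<close>: along
  \<open>Y\<close> in the first, and along \<open>cvec_cnj X\<close> after conjugating the
  second.\<close>

lemma pushforward2_mixed: "snd X = 0 \<Longrightarrow> fst Y = 0 \<Longrightarrow> pushforward2 f p X Y = 0"
  using dbar1[of Y X] dbar1'[of "cvec_cnj X" "cvec_cnj Y"]
  by (simp add: pushforward2_eq f_nth_cnj zero_prod_def)

lemma snd_pushforward2: "snd X = 0 \<Longrightarrow> snd (pushforward2 f p X Y) = 0"
  using dbar1'[of "cvec_cnj X" "cvec_cnj Y"] by (simp add: pushforward2_eq f_nth_cnj)

lemma pushforward3_mixed:
  "snd X = 0 \<Longrightarrow> fst Y = 0 \<Longrightarrow> cvec_deriv Z (\<lambda>z. pushforward2 f z X Y) p = 0"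
  using dbar2[of Y Z X] dbar2'[of "cvec_cnj X" "cvec_cnj Z" "cvec_cnj Y"]
  by (simp add: pushforward2_eq cvec_deriv_def f_nth_cnj zero_prod_def)

context
  fixes g :: "complex^'n \<Rightarrow> complex" and W :: "(complex^'n) set"
  assumes open_W: "open W" and fU: "f ` U \<subseteq> W" and g_C3: "Ck_on 3 g W"
begin

lemma g_differentiable: "g differentiable (at (f p))"
  using Ck_on_imp_differentiable[OF g_C3 open_W] fU p_in_U by auto

lemma act_compose: "cvec_act X (\<lambda>z. g (f z)) p = cvec_act (pushforward f p X) g (f p)"
  by (rule cvec_act_compose[OF f_differentiable g_differentiable])

lemma act_compose_mixed:
  assumes "snd X = 0" "fst Y = 0"
  shows "cvec_act X (cvec_act Y (\<lambda>z. g (f z))) p =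
    cvec_act (pushforward f p X) (cvec_act (pushforward f p Y) g) (f p)"
  using pushforward2_mixed[of X Y] assms
  by (simp add: cvec_act_compose2[OF f_C3 g_C3 _ open_U open_W fU p_in_U])

lemma act_compose_second:
  "cvec_act X (cvec_act Y (\<lambda>z. g (f z))) p =
    cvec_act (pushforward2 f p X Y) g (f p) +
    cvec_act (pushforward f p X) (cvec_act (pushforward f p Y) g) (f p)"
  by (simp add: cvec_act_compose2[OF f_C3 g_C3 _ open_U open_W fU p_in_U])

text \<open>Of the five terms, the three in which \<open>Y\<close> is paired with \<open>X\<close>
  or \<open>Z\<close> inside a derivative of \<open>f\<close> vanish. The Hessian of
  \<open>f\<close> in the two (1,0) vectors survives, as for a holomorphic map.\<close>

lemma act_compose_third:
  assumes "snd X = 0" "fst Y = 0" "snd Z = 0"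
  shows "cvec_act Z (cvec_act X (cvec_act Y (\<lambda>z. g (f z)))) p =
    cvec_act (pushforward2 f p Z X) (cvec_act (pushforward f p Y) g) (f p) +
    cvec_act (pushforward f p Z) (cvec_act (pushforward f p X) (cvec_act (pushforward f p Y) g)) (f p)"
proof -
  have "cvec_act 0 g = (\<lambda>z. 0)" by (simp add: fun_eq_iff)
  then show ?thesis
    using pushforward2_mixed[of X Y] pushforward2_mixed[of Z Y] pushforward3_mixed[OF assms(1,2), of Z] assms
    by (simp add: cvec_act_compose3[OF f_C3 g_C3 _ open_U open_W fU p_in_U])
qed

end

end

section \<open>The D'Angelo form of a regular function\<close>

lemma cvec_act_cnj_real:
  fixes \<rho> :: "complex^'n::finite \<Rightarrow> real"
  assumes "(\<lambda>z. complex_of_real (\<rho> z)) differentiable (at p)"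
  shows "cvec_act (cvec_cnj X) (\<lambda>z. complex_of_real (\<rho> z)) p = cnj (cvec_act X (\<lambda>z. complex_of_real (\<rho> z)) p)"
  using cvec_act_cnj[OF assms, of "cvec_cnj X"] by simp

text \<open>\<open>d01\<close> kills the first vector and \<open>d10\<close> the second. Since
  \<partial> enters with the opposite sign compared to the exterior derivative, the two remaining
  terms add up instead of being subtracted.\<close>

lemma dc_form_eq:
  "dc_form \<omega> p (a, 0) (0, b) =
     - \<i> * (cvec_act (0, b) (\<lambda>z. \<omega> z (a, 0)) p + cvec_act (a, 0) (\<lambda>z. \<omega> z (0, b)) p)"
  by (simp add: dc_form_def delbar_form_def del_form_def cvec_act_def d10_def d01_def algebra_simps)

text \<open>The local setting of the D'Angelo form: three derivatives make the form differentiable,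
  and the nonvanishing gradient on an open set makes \<open>normal_field\<close> a differentiable
  field there.\<close>

locale regular_function =
  fixes \<rho> :: "complex^'n::finite \<Rightarrow> real" and U :: "(complex^'n) set"
  assumes open_U: "open U" and C3: "Ck_on 3 (\<lambda>z. complex_of_real (\<rho> z)) U"
    and dz_nonzero: "\<And>z. z \<in> U \<Longrightarrow> \<exists>j. dz j (\<lambda>z. complex_of_real (\<rho> z)) z \<noteq> 0"
begin

abbreviation R :: "complex^'n \<Rightarrow> complex" where "R \<equiv> (\<lambda>z. complex_of_real (\<rho> z))"
abbreviation N :: "complex^'n \<Rightarrow> 'n cvec" where "N \<equiv> normal_field \<rho>"

lemma R_differentiable: "z \<in> U \<Longrightarrow> R differentiable (at z)"
  using Ck_on_imp_differentiable[OF C3 open_U] by simp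

lemma dR_differentiable: "z \<in> U \<Longrightarrow> cvec_act X R differentiable (at z)"
  using cvec_act_differentiable[OF C3 open_U] by simp

lemma dR_C2: "Ck_on 2 (cvec_act X R) U"
  using Ck_on_cvec_act[of 2 R U X] C3 open_U by simp

lemma R_commute: "z \<in> U \<Longrightarrow> cvec_act X (cvec_act Y R) z = cvec_act Y (cvec_act X R) z"
  using cvec_act_commute[OF C3 _ open_U] by simp

lemma R_cnj: "z \<in> U \<Longrightarrow> cvec_act (cvec_cnj X) R z = cnj (cvec_act X R z)"
  by (rule cvec_act_cnj_real[OF R_differentiable])

lemma R_cnj2: "z \<in> U \<Longrightarrow> cvec_act (cvec_cnj X) (cvec_act (cvec_cnj Y) R) z = cnj (cvec_act X (cvec_act Y R) z)"
  using cvec_act2_cnj[OF C3 _ open_U, of z "cvec_cnj X" "cvec_cnj Y"] by simp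

lemma dzbar_R: "z \<in> U \<Longrightarrow> dzbar j R z = cnj (dz j R z)"
proof -
  have "(0, axis j 1) = cvec_cnj (axis j (1::complex), 0)"
    by (simp add: cvec_cnj_def vec_eq_iff axis_def)
  then show "z \<in> U \<Longrightarrow> dzbar j R z = cnj (dz j R z)"
    using R_cnj by (simp add: dz_eq_cvec_act dzbar_eq_cvec_act)
qed

text \<open>The denominator of \<open>normal_field\<close>, with products in place of squared moduli
  so that the rules of differentiation apply.\<close>

definition grad_sq :: "complex^'n \<Rightarrow> complex" where
  "grad_sq z = (\<Sum>l\<in>UNIV. dz l R z * cnj (dz l R z))"

lemma grad_sq_eq: "complex_of_real (\<Sum>l\<in>UNIV. (cmod (dz l R z))\<^sup>2) = grad_sq z"
  by (simp add: grad_sq_def complex_norm_square del: of_real_power)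

lemma grad_sq_nonzero: "z \<in> U \<Longrightarrow> grad_sq z \<noteq> 0"
  using dz_nonzero[of z] unfolding grad_sq_eq[symmetric]
  by (simp add: sum_nonneg_eq_0_iff del: of_real_sum)

lemma N_eq: "N z = ((\<chi> j. dzbar j R z / grad_sq z), 0)"
  by (simp only: normal_field_def grad_sq_eq)

lemma snd_N [simp]: "snd (N z) = 0"
  by (simp add: N_eq)

lemma N_differentiable: "z \<in> U \<Longrightarrow> cvec_differentiable N z"
  using dz_dzbar_differentiable[OF C3 open_U, of z] grad_sq_nonzero[of z]
  by (auto simp: cvec_differentiable_def N_eq grad_sq_def[abs_def]
      intro!: differentiable_divide differentiable_sum differentiable_mult differentiable_cnj)

lemma act_N_R: "z \<in> U \<Longrightarrow> cvec_act (N z) R z = 1"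
proof -
  assume z: "z \<in> U"
  have "cvec_act (N z) R z = (\<Sum>j\<in>UNIV. dzbar j R z / grad_sq z * dz j R z)"
    by (simp add: cvec_act_expand N_eq)
  also have "\<dots> = grad_sq z / grad_sq z"
    unfolding grad_sq_def[of z] sum_divide_distrib by (simp add: dzbar_R[OF z] mult.commute)
  finally show ?thesis using grad_sq_nonzero[OF z] by simp
qed

lemma cnj_N_differentiable: "z \<in> U \<Longrightarrow> cvec_differentiable (\<lambda>z. cvec_cnj (N z)) z"
  using N_differentiable by (simp add: cvec_differentiable_def differentiable_cnj)

lemma act_cnj_N_R: "z \<in> U \<Longrightarrow> cvec_act (cvec_cnj (N z)) R z = 1"
  by (simp add: R_cnj act_N_R)

text \<open>Since \<open>\<eta>(T) = 1\<close>, Cartan's formula leaves \<open>\<alpha> = - d\<eta>(T, _)\<close>.\<close>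

lemma dangelo_form_eq:
  assumes z: "z \<in> U"
  shows "dangelo_form \<rho> z X =
    (cvec_act X (cvec_act (N z + cvec_cnj (N z)) R) z
     - cvec_act (N z - cvec_cnj (N z)) (cvec_act (fst X, - snd X) R) z) / 2"
proof -
  \<comment> \<open>Both \<open>T_field\<close> and \<open>eta_form\<close> carry a minus sign on
    their (0,1) part. In \<eta> of the bracket the signs cancel, which leaves the derivative of the
    sum \<open>T'\<close>.\<close>
  define T' where "T' = (\<lambda>z. N z + cvec_cnj (N z))"
  have T'_diff: "cvec_differentiable T' z"
    using N_differentiable[OF z] cnj_N_differentiable[OF z]
    by (simp add: cvec_differentiable_def T'_def)
  have eta: "eta_form \<rho> w Y = (1 / 2) * cvec_act (fst Y, - snd Y) R w" for w Y
    by (simp add: eta_form_def cvec_act_def d10_def d01_def sum_negf)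
  \<comment> \<open>\<open>T'\<close> applied to \<open>R\<close> is constantly 2; differentiating
    this trades the derivative of the coefficients of \<open>T'\<close> for a second derivative of
    \<open>R\<close>.\<close>
  have "cvec_act X (\<lambda>w. cvec_act (T' w) R w) z = cvec_act X (\<lambda>w. 2) z"
    by (rule cvec_act_cong[OF open_U z]) (simp add: T'_def cvec_act_plus_vec act_N_R act_cnj_N_R)
  then have X2: "cvec_act (cvec_deriv X T' z) R z = - cvec_act X (cvec_act (T' z) R) z"
    by (simp add: cvec_act_variable_ident[OF C3 open_U z _ T'_diff] eq_neg_iff_add_eq_0)
  have fst: "fst (lie_bracket (T_field \<rho>) (\<lambda>_. X) z) = - fst (cvec_deriv X T' z)"
    by (simp add: lie_bracket_def T_field_def cvec_deriv_def T'_def vec_eq_iff)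
  have snd: "snd (lie_bracket (T_field \<rho>) (\<lambda>_. X) z) = snd (cvec_deriv X T' z)"
    using cnj_N_differentiable[OF z] cvec_act_cmult[of _ z X "- 1"]
    by (simp add: lie_bracket_def T_field_def cvec_deriv_def T'_def vec_eq_iff cvec_differentiable_def)
  have "dangelo_form \<rho> z X = - (cvec_act (T_field \<rho> z) (\<lambda>w. (1 / 2) * cvec_act (fst X, - snd X) R w) z
     - (1 / 2) * cvec_act (- cvec_deriv X T' z) R z)"
    unfolding dangelo_form_def lie_derivative_def eta fst snd
    by (simp add: prod_eq_iff[symmetric] uminus_prod_def)
  also have "\<dots> = (cvec_act X (cvec_act (T' z) R) z
     - cvec_act (N z - cvec_cnj (N z)) (cvec_act (fst X, - snd X) R) z) / 2"
    unfolding cvec_act_cmult[OF dR_differentiable[OF z]] cvec_act_minus_vec X2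
    by (simp add: T_field_def field_simps)
  finally show ?thesis by (simp add: T'_def)
qed

text \<open>On (0,1) vectors the sign change gives \<open>- X\<close>; by symmetry of the Hessian
  the terms with the conjugate of \<open>N\<close> cancel and those with \<open>N\<close>
  double.\<close>

lemma dangelo_form_01:
  assumes "z \<in> U" "fst X = 0"
  shows "dangelo_form \<rho> z X = cvec_act (N z) (cvec_act X R) z"
proof -
  have "(fst X, - snd X) = - X" using assms(2) by (simp add: prod_eq_iff)
  moreover have "cvec_act Y (cvec_act (- X) R) z = - cvec_act Y (cvec_act X R) z" for Y
    using cvec_act_cmult[OF dR_differentiable[OF assms(1)], of Y "-1" X]
    by (simp add: cvec_act_minus_vec[abs_def])
  ultimately show ?thesis
    by (simp add: dangelo_form_eq[OF assms(1)] R_commute[OF assms(1), of X]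
        cvec_act_plus_vec cvec_act_diff_vec)
qed

text \<open>Reality of \<alpha>: here the terms with \<open>N\<close> cancel, and what is left is
  the conjugate of the (0,1) formula because \<open>R\<close> is real.\<close>

lemma dangelo_form_10:
  assumes "z \<in> U" "snd X = 0"
  shows "dangelo_form \<rho> z X = cnj (dangelo_form \<rho> z (cvec_cnj X))"
proof -
  have "(fst X, - snd X) = X" using assms(2) by (simp add: prod_eq_iff)
  then have "dangelo_form \<rho> z X = cvec_act (cvec_cnj (N z)) (cvec_act X R) z"
    by (simp add: dangelo_form_eq[OF assms(1)] R_commute[OF assms(1), of X]
        cvec_act_plus_vec cvec_act_diff_vec)
  also have "\<dots> = cnj (cvec_act (N z) (cvec_act (cvec_cnj X) R) z)"
    using R_cnj2[OF assms(1), of "N z" "cvec_cnj X"] by simp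
  finally show ?thesis
    using assms by (simp add: dangelo_form_01)
qed

lemma dangelo_form_01_differentiable:
  assumes "p \<in> U" "fst X = 0"
  shows "(\<lambda>z. dangelo_form \<rho> z X) differentiable (at p)"
  using cvec_act_variable_ident(1)[OF dR_C2 open_U assms(1) order_refl N_differentiable[OF assms(1)]]
  by (rule differentiable_transform_open[OF _ open_U assms(1)]) (simp add: dangelo_form_01 assms(2))

lemma dc_dangelo_form:
  assumes "p \<in> U" "snd L = 0"
  shows "dc_form (dangelo_form \<rho>) p L (cvec_cnj L) =
    - \<i> * (cnj (cvec_act L (\<lambda>z. dangelo_form \<rho> z (cvec_cnj L)) p)
            + cvec_act L (\<lambda>z. dangelo_form \<rho> z (cvec_cnj L)) p)"
proof -
  have L: "L = (fst L, 0)" "cvec_cnj L = (0, snd (cvec_cnj L))"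
    using assms(2) by (simp_all add: prod_eq_iff)
  have "cvec_act (cvec_cnj L) (\<lambda>z. dangelo_form \<rho> z L) p
      = cvec_act (cvec_cnj L) (\<lambda>z. cnj (dangelo_form \<rho> z (cvec_cnj L))) p"
    using assms by (intro cvec_act_cong[OF open_U]) (auto intro: dangelo_form_10)
  also have "\<dots> = cnj (cvec_act L (\<lambda>z. dangelo_form \<rho> z (cvec_cnj L)) p)"
    using assms by (simp add: cvec_act_cnj[OF dangelo_form_01_differentiable])
  finally show ?thesis
    using dc_form_eq[of "dangelo_form \<rho>" p "fst L" "snd (cvec_cnj L)", folded L] by simp
qed

section \<open>Null vectors of the Levi form\<close>

text \<open>The null space in operator form, to which chain rules apply directly. Compared with
  \<open>levi_null_space\<close>, \<open>L\<close> stands in the conjugated slot, which Hermitian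
  symmetry permits.\<close>

definition levi_null_at :: "complex^'n \<Rightarrow> 'n cvec \<Rightarrow> bool" where
  "levi_null_at p L \<longleftrightarrow> snd L = 0 \<and> cvec_act L R p = 0 \<and>
     (\<forall>X. snd X = 0 \<longrightarrow> cvec_act X R p = 0 \<longrightarrow> cvec_act X (cvec_act (cvec_cnj L) R) p = 0)"

text \<open>Because \<open>N\<close> acts as 1 on \<open>R\<close>, subtracting the multiple
  \<open>X R\<close> of \<open>N\<close> from \<open>X\<close> leaves a tangential vector, on which
  the null condition gives zero.\<close>

lemma null_split:
  assumes "p \<in> U" "levi_null_at p L" "snd X = 0"
  shows "cvec_act X (cvec_act (cvec_cnj L) R) p
       = cvec_act X R p * cvec_act (N p) (cvec_act (cvec_cnj L) R) p"
proof -
  let ?Y = "X - cvec_scale (cvec_act X R p) (N p)"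
  have "snd ?Y = 0"
    using assms by (simp add: cvec_scale_def)
  moreover have "cvec_act ?Y R p = 0"
    using assms by (simp add: cvec_act_diff_vec cvec_act_scale_vec act_N_R)
  ultimately have "cvec_act ?Y (cvec_act (cvec_cnj L) R) p = 0"
    using assms(2) levi_null_at_def by blast
  then show ?thesis by (simp add: cvec_act_diff_vec cvec_act_scale_vec)
qed

text \<open>Eliminates the derivative of the field \<open>N\<close>: by \<open>null_split\<close> it
  enters only through its action on \<open>R\<close>, so just the value of \<open>N\<close> at
  \<open>p\<close> remains.\<close>

lemma act_dangelo_form_null:
  assumes p: "p \<in> U" and L: "levi_null_at p L"
  shows "cvec_act L (\<lambda>z. dangelo_form \<rho> z (cvec_cnj L)) p =
    cvec_act L (cvec_act (N p) (cvec_act (cvec_cnj L) R)) p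
    - cvec_act L (cvec_act (N p) R) p * cvec_act (N p) (cvec_act (cvec_cnj L) R) p"
proof -
  have L0: "snd L = 0" using L by (simp add: levi_null_at_def)
  let ?V = "cvec_deriv L N p"
  have "cvec_act L (\<lambda>z. dangelo_form \<rho> z (cvec_cnj L)) p
      = cvec_act L (\<lambda>z. cvec_act (N z) (cvec_act (cvec_cnj L) R) z) p"
    using L0 by (intro cvec_act_cong[OF open_U p]) (simp add: dangelo_form_01)
  also have "\<dots> = cvec_act ?V (cvec_act (cvec_cnj L) R) p + cvec_act L (cvec_act (N p) (cvec_act (cvec_cnj L) R)) p"
    by (rule cvec_act_variable_ident(2)[OF dR_C2 open_U p order_refl N_differentiable[OF p]])
  also have "cvec_act ?V (cvec_act (cvec_cnj L) R) p
      = cvec_act ?V R p * cvec_act (N p) (cvec_act (cvec_cnj L) R) p"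
    by (rule null_split[OF p L]) (simp add: cvec_deriv_def)
  \<comment> \<open>Differentiate \<open>N R = 1\<close> along \<open>L\<close>.\<close>
  also have "cvec_act ?V R p = - cvec_act L (cvec_act (N p) R) p"
  proof -
    have "cvec_act L (\<lambda>z. cvec_act (N z) R z) p = cvec_act L (\<lambda>z. 1) p"
      by (rule cvec_act_cong[OF open_U p act_N_R])
    then show ?thesis
      by (simp add: cvec_act_variable_ident[OF C3 open_U p _ N_differentiable[OF p]] eq_neg_iff_add_eq_0)
  qed
  finally show ?thesis by simp
qed

text \<open>The tangential part of \<open>L\<close>, extended to a field that is tangential to every level set.\<close>

definition tangential :: "'n cvec \<Rightarrow> complex^'n \<Rightarrow> 'n cvec" where
  "tangential L z = L - cvec_scale (cvec_act L R z) (N z)"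

lemma act_tangential: "z \<in> U \<Longrightarrow> cvec_act (tangential L z) R z = 0"
  by (simp add: tangential_def cvec_act_diff_vec cvec_act_scale_vec act_N_R)

lemma snd_tangential: "snd L = 0 \<Longrightarrow> snd (tangential L z) = 0"
  by (simp add: tangential_def cvec_scale_def)

lemma tangential_nth: "fst (tangential L z) $ l = fst L $ l - cvec_act L R z * fst (N z) $ l"
  by (simp add: tangential_def cvec_scale_def)

lemma tangential_differentiable: "p \<in> U \<Longrightarrow> snd L = 0 \<Longrightarrow> cvec_differentiable (tangential L) p"
  using N_differentiable[of p] dR_differentiable[of p L]
  by (simp add: cvec_differentiable_def tangential_nth snd_tangential)

text \<open>The vectors are frozen at \<open>z\<close> before differentiating, so this is the Levi
  form at \<open>z\<close> on the tangential field, with no derivatives of its coefficients.\<close>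

definition levi_quadratic :: "'n cvec \<Rightarrow> complex^'n \<Rightarrow> complex" where
  "levi_quadratic L z = cvec_act (tangential L z) (cvec_act (cvec_cnj (tangential L z)) R) z"

text \<open>Of the two coefficient derivatives only that of the outer field survives; it is a
  multiple of \<open>N\<close> and produces the correction term.\<close>

lemma act_levi_quadratic:
  assumes p: "p \<in> U" and L: "levi_null_at p L" and W: "snd W = 0" "cvec_act W R p = 0"
  shows "levi_quadratic L differentiable (at p)"
    and "cvec_act W (levi_quadratic L) p =
    cvec_act W (cvec_act L (cvec_act (cvec_cnj L) R)) p
    - cvec_act W (cvec_act L R) p * cvec_act (N p) (cvec_act (cvec_cnj L) R) p"
proof -
  have L0: "snd L = 0" and LR: "cvec_act L R p = 0" using L by (simp_all add: levi_null_at_def)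
  have tp: "tangential L p = L" using LR by (simp add: tangential_def cvec_scale_def prod_eq_iff)
  have td: "cvec_differentiable (tangential L) p" by (rule tangential_differentiable[OF p L0])
  have tcd: "cvec_differentiable (\<lambda>z. cvec_cnj (tangential L z)) p"
    using td by (simp add: cvec_differentiable_def differentiable_cnj)
  have Nd: "(\<lambda>z. fst (N z) $ l) differentiable (at p)" for l
    using N_differentiable[OF p] by (simp add: cvec_differentiable_def)
  have deriv: "cvec_act Y (\<lambda>z. fst (tangential L z) $ l) p = - cvec_act Y (cvec_act L R) p * fst (N p) $ l" for Y l
    using Nd dR_differentiable[OF p]
    by (simp add: tangential_nth cvec_act_diff cvec_act_mult LR)
  have 1: "cvec_deriv W (tangential L) p = - cvec_scale (cvec_act W (cvec_act L R) p) (N p)"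
    using L0 by (simp add: cvec_deriv_def deriv snd_tangential cvec_scale_def prod_eq_iff vec_eq_iff)
  \<comment> \<open>This factor multiplies the derivative of the conjugated field; it vanishes since
    \<open>L\<close> is null and \<open>W\<close> tangential.\<close>
  have "cvec_act (cvec_cnj W) (cvec_act L R) p = cnj (cvec_act W (cvec_act (cvec_cnj L) R) p)"
    using R_cnj2[OF p, of W "cvec_cnj L"] by simp
  also have "\<dots> = 0" using L W unfolding levi_null_at_def by (metis complex_cnj_zero)
  finally have "cvec_act (cvec_cnj W) (cvec_act L R) p = 0" .
  then have 2: "cvec_deriv W (\<lambda>z. cvec_cnj (tangential L z)) p = 0"
    using td L0
    by (simp add: cvec_deriv_def cvec_act_cnj cvec_differentiable_def deriv snd_tangential prod_eq_iff)
  have "levi_quadratic L = (\<lambda>z. cvec_act (tangential L z) (cvec_act (cvec_cnj (tangential L z)) R) z)"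
    by (simp add: levi_quadratic_def fun_eq_iff)
  moreover have "cvec_act 0 R = (\<lambda>z. 0)" by (simp add: fun_eq_iff)
  ultimately show "cvec_act W (levi_quadratic L) p =
    cvec_act W (cvec_act L (cvec_act (cvec_cnj L) R)) p
    - cvec_act W (cvec_act L R) p * cvec_act (N p) (cvec_act (cvec_cnj L) R) p"
    using cvec_act_variable2[OF C3 open_U order_refl open_U p _ _ tcd td, of "\<lambda>z. z" W]
    by (simp add: 1 2 tp cvec_act_minus_vec cvec_act_scale_vec)
  show "levi_quadratic L differentiable (at p)"
  proof -
    have "(\<lambda>z. (\<Sum>l\<in>UNIV. snd (cvec_cnj (tangential L z)) $ l * cvec_act (tangential L z) (dzbar l R) z)) differentiable (at p)"
      using tcd cvec_act_variable_ident(1)[OF dz_dzbar_Ck_on(2) open_U p order_refl td] C3 open_U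
      by (auto simp: cvec_differentiable_def numeral_3_eq_3 simp del: cvec_cnj_simps Ck_on.simps intro!: differentiable_sum differentiable_mult)
    then show ?thesis
      by (rule differentiable_transform_open[OF _ open_U p])
         (use L0 in \<open>simp add: levi_quadratic_def cvec_act_act_expand[OF C3 open_U] snd_tangential\<close>)
  qed
qed

end

section \<open>The boundary of a domain\<close>

text \<open>The directions \<open>w n\<close> may vary, because boundary points approach
  \<open>p\<close> along directions that are tangential only in the limit.\<close>

lemma difference_quotient_tendsto:
  fixes \<phi> :: "'a::real_normed_vector \<Rightarrow> 'b::real_normed_vector"
  assumes D: "(\<phi> has_derivative \<phi>') (at p)"
    and t: "\<And>n::nat. 0 < t n" "t \<longlonglongrightarrow> 0" and w: "w \<longlonglongrightarrow> v"
  shows "(\<lambda>n. (\<phi> (p + t n *\<^sub>R w n) - \<phi> p) /\<^sub>R t n) \<longlonglongrightarrow> \<phi>' v"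
proof -
  \<comment> \<open>Division by zero makes \<open>e 0 = 0\<close>, so differentiability says exactly
    that \<open>e\<close> is continuous at 0.\<close>
  define e where "e h = norm (\<phi> (p + h) - \<phi> p - \<phi>' h) / norm h" for h
  have lin: "linear \<phi>'" and bl: "bounded_linear \<phi>'"
    using D has_derivative_linear has_derivative_bounded_linear by blast+
  have "isCont e 0"
    using D by (simp add: isCont_def e_def[abs_def] has_derivative_at)
  moreover have h: "(\<lambda>n. t n *\<^sub>R w n) \<longlonglongrightarrow> 0"
    using tendsto_scaleR[OF t(2) w] by simp
  ultimately have "(\<lambda>n. e (t n *\<^sub>R w n)) \<longlonglongrightarrow> 0"
    using isCont_tendsto_compose[of 0 e "\<lambda>n. t n *\<^sub>R w n"] by (simp add: e_def)
  then have lim: "(\<lambda>n. e (t n *\<^sub>R w n) * norm (w n)) \<longlonglongrightarrow> 0"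
    using tendsto_mult[OF _ tendsto_norm[OF w], of "\<lambda>n. e (t n *\<^sub>R w n)" 0] by simp
  have "norm ((\<phi> (p + t n *\<^sub>R w n) - \<phi> p) /\<^sub>R t n - \<phi>' (w n)) = e (t n *\<^sub>R w n) * norm (w n)" for n
  proof -
    have eq: "(\<phi> (p + t n *\<^sub>R w n) - \<phi> p) /\<^sub>R t n - \<phi>' (w n)
        = (\<phi> (p + t n *\<^sub>R w n) - \<phi> p - \<phi>' (t n *\<^sub>R w n)) /\<^sub>R t n"
      using t(1)[of n] by (simp add: linear_scale[OF lin] scaleR_diff_right)
    show ?thesis
    proof (cases "w n = 0")
      case True
      then show ?thesis using linear_0[OF lin] by (simp add: e_def)
    next
      case False
      then show ?thesis
        using t(1)[of n] by (simp only: eq e_def norm_scaleR) (simp only: divide_inverse abs_inverse abs_of_pos, simp)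
    qed
  qed
  with lim have "(\<lambda>n. (\<phi> (p + t n *\<^sub>R w n) - \<phi> p) /\<^sub>R t n - \<phi>' (w n)) \<longlonglongrightarrow> 0"
    by (subst tendsto_norm_zero_iff[symmetric]) simp
  from tendsto_add[OF this bounded_linear.tendsto[OF bl w]] show ?thesis by simp
qed

lemma tendsto_add_scaled:
  fixes p :: "'a::real_normed_vector"
  assumes "t \<longlonglongrightarrow> 0" "w \<longlonglongrightarrow> v"
  shows "(\<lambda>n. p + t n *\<^sub>R w n) \<longlonglongrightarrow> p"
  using tendsto_add[OF tendsto_const tendsto_scaleR[OF assms], of p] by simp

lemma Ck_on_of_real:
  "open U \<Longrightarrow> Ck_on k r U \<Longrightarrow> Ck_on k (\<lambda>z. complex_of_real (r z)) U"
  by (rule Ck_on_bounded_linear[OF bounded_linear_of_real])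

lemma cvec_act_of_real:
  assumes "r differentiable (at p)"
  shows "cvec_act X (\<lambda>z. complex_of_real (r z)) p =
    Complex (frechet_derivative r (at p) (cvec_re X)) (frechet_derivative r (at p) (cvec_im X))"
  using cvec_act_has_derivative[OF bounded_linear.has_derivative[OF bounded_linear_of_real], of r _ p X]
    assms[unfolded frechet_derivative_works]
  by (simp add: complex_eq_iff)

text \<open>A defining function with its neighborhood fixed. The class is C^2 so that the function
  supplied by \<open>pseudoconvex\<close> is an instance too.\<close>

locale domain_boundary =
  fixes \<Omega> :: "(complex^'n::finite) set" and r :: "complex^'n \<Rightarrow> real" and V :: "(complex^'n) set"
  assumes open_\<Omega>: "open \<Omega>" and open_V: "open V" and closure_V: "closure \<Omega> \<subseteq> V"
    and r_C2: "Ck_on 2 r V" and \<Omega>_eq: "\<Omega> = {z\<in>V. r z < 0}"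
    and dr_nonzero: "\<And>p. p \<in> frontier \<Omega> \<Longrightarrow> frechet_derivative r (at p) \<noteq> (\<lambda>v. 0)"
begin

abbreviation R :: "complex^'n \<Rightarrow> complex" where "R \<equiv> (\<lambda>z. complex_of_real (r z))"

lemma frontier_V: "p \<in> frontier \<Omega> \<Longrightarrow> p \<in> V"
  using closure_V by (auto simp: frontier_def)

lemma frontier_zero:
  assumes "p \<in> frontier \<Omega>"
  shows "r p = 0"
proof -
  have pV: "p \<in> V" and pn: "p \<notin> \<Omega>" and pc: "p \<in> closure \<Omega>"
    using assms frontier_V open_\<Omega> by (auto simp: frontier_def interior_open)
  have "r p \<ge> 0" using pV pn \<Omega>_eq by force
  moreover obtain x where x: "\<And>n. x n \<in> \<Omega>" "x \<longlonglongrightarrow> p"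
    using pc unfolding closure_sequential by blast
  have "isCont r p"
    using Ck_on_imp_continuous_on[OF r_C2] open_V pV continuous_on_eq_continuous_at by blast
  then have "(\<lambda>n. r (x n)) \<longlonglongrightarrow> r p" using x(2) by (rule isCont_tendsto_compose)
  moreover have "r (x n) \<le> 0" for n using x(1)[of n] \<Omega>_eq by force
  ultimately show ?thesis using LIMSEQ_le_const2[of "\<lambda>n. r (x n)" "r p" 0] by fastforce
qed

lemma r_differentiable: "p \<in> V \<Longrightarrow> r differentiable (at p)"
  using Ck_on_imp_differentiable[OF r_C2 open_V] by simp

lemma r_derivative: "p \<in> V \<Longrightarrow> (r has_derivative frechet_derivative r (at p)) (at p)"
  using r_differentiable frechet_derivative_works by blast

lemma R_C2: "Ck_on 2 R V"
  by (rule Ck_on_of_real[OF open_V r_C2])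

lemma dr_eq_1:
  assumes "p \<in> frontier \<Omega>"
  obtains \<nu> where "frechet_derivative r (at p) \<nu> = 1"
proof -
  have lin: "linear (frechet_derivative r (at p))"
    using r_differentiable[OF frontier_V[OF assms]] by (rule linear_frechet_derivative)
  obtain v where "frechet_derivative r (at p) v \<noteq> 0"
    using dr_nonzero[OF assms] by auto
  then have "frechet_derivative r (at p) (v /\<^sub>R frechet_derivative r (at p) v) = 1"
    by (simp add: linear_scale[OF lin])
  then show ?thesis by (rule that)
qed

text \<open>Replaces a curve in the boundary. Tilting \<open>v\<close> slightly against and along a
  transversal \<nu> gives a short segment from inside \<Omega> to outside, which meets the frontier
  by connectedness.\<close>

lemma tangent_sequence:
  assumes p: "p \<in> frontier \<Omega>" and v: "frechet_derivative r (at p) v = 0"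
  obtains t :: "nat \<Rightarrow> real" and w where "\<And>n. 0 < t n" "t \<longlonglongrightarrow> 0" "w \<longlonglongrightarrow> v"
    "\<And>n. p + t n *\<^sub>R w n \<in> frontier \<Omega>"
proof -
  let ?D = "frechet_derivative r (at p)"
  have pV: "p \<in> V" by (rule frontier_V[OF p])
  have lin: "linear ?D" using r_derivative[OF pV] has_derivative_linear by blast
  obtain \<nu> where \<nu>: "?D \<nu> = 1" using dr_eq_1[OF p] .
  define \<epsilon> where "\<epsilon> n = inverse (real (Suc n))" for n
  have \<epsilon>: "0 < \<epsilon> n" for n by (simp add: \<epsilon>_def)
  have \<epsilon>_lim: "\<epsilon> \<longlonglongrightarrow> 0" unfolding \<epsilon>_def by (rule LIMSEQ_inverse_real_of_nat)
  have "\<exists>s w. 0 < s \<and> s \<le> \<epsilon> n \<and> norm (w - v) \<le> \<epsilon> n * norm \<nu> \<and> p + s *\<^sub>R w \<in> frontier \<Omega>" for n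
  proof -
    let ?a = "v - \<epsilon> n *\<^sub>R \<nu>" and ?b = "v + \<epsilon> n *\<^sub>R \<nu>"
    have "(\<lambda>m. (r (p + \<epsilon> m *\<^sub>R c) - r p) /\<^sub>R \<epsilon> m) \<longlonglongrightarrow> ?D c" for c
      by (rule difference_quotient_tendsto[OF r_derivative[OF pV] \<epsilon> \<epsilon>_lim tendsto_const])
    then have lim: "(\<lambda>m. r (p + \<epsilon> m *\<^sub>R c) / \<epsilon> m) \<longlonglongrightarrow> ?D c" for c
      by (simp add: frontier_zero[OF p] divide_inverse_commute)
    have "?D ?a < 0" "?D ?b > 0"
      using \<nu> v \<epsilon>[of n] by (simp_all add: linear_add[OF lin] linear_diff[OF lin] linear_scale[OF lin])
    then have "\<forall>\<^sub>F m in sequentially. r (p + \<epsilon> m *\<^sub>R ?a) / \<epsilon> m < 0" "\<forall>\<^sub>F m in sequentially. 0 < r (p + \<epsilon> m *\<^sub>R ?b) / \<epsilon> m"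
      using order_tendstoD[OF lim] by blast+
    moreover have "(\<lambda>m. p + \<epsilon> m *\<^sub>R ?a) \<longlonglongrightarrow> p"
      by (rule tendsto_add_scaled[OF \<epsilon>_lim tendsto_const])
    then have "\<forall>\<^sub>F m in sequentially. p + \<epsilon> m *\<^sub>R ?a \<in> V"
      using open_V pV by (rule topological_tendstoD)
    \<comment> \<open>The clause \<open>n \<le> m\<close> bounds the step length by
      \<open>\<epsilon> n\<close>, so the steps shrink together with the tilt.\<close>
    ultimately have "\<forall>\<^sub>F m in sequentially. r (p + \<epsilon> m *\<^sub>R ?a) / \<epsilon> m < 0 \<and> 0 < r (p + \<epsilon> m *\<^sub>R ?b) / \<epsilon> m
        \<and> p + \<epsilon> m *\<^sub>R ?a \<in> V \<and> n \<le> m"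
      using eventually_ge_at_top by eventually_elim auto
    then obtain m where m: "r (p + \<epsilon> m *\<^sub>R ?a) / \<epsilon> m < 0" "0 < r (p + \<epsilon> m *\<^sub>R ?b) / \<epsilon> m"
        "p + \<epsilon> m *\<^sub>R ?a \<in> V" "n \<le> m"
      using eventually_happens'[OF sequentially_bot] by blast
    have "p + \<epsilon> m *\<^sub>R ?a \<in> \<Omega>" "p + \<epsilon> m *\<^sub>R ?b \<notin> \<Omega>"
      using m \<epsilon>[of m] by (auto simp: \<Omega>_eq divide_less_0_iff zero_less_divide_iff)
    then have "closed_segment (p + \<epsilon> m *\<^sub>R ?a) (p + \<epsilon> m *\<^sub>R ?b) \<inter> frontier \<Omega> \<noteq> {}"
      by (intro connected_Int_frontier) auto
    then obtain u where u: "0 \<le> u" "u \<le> 1" and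
      x: "(1 - u) *\<^sub>R (p + \<epsilon> m *\<^sub>R ?a) + u *\<^sub>R (p + \<epsilon> m *\<^sub>R ?b) \<in> frontier \<Omega>"
      by (auto simp: closed_segment_def)
    \<comment> \<open>The crossing point belongs to the tilt
      \<open>(2 * u - 1) * \<epsilon> n\<close>, of size at most \<open>\<epsilon> n\<close> for
      \<open>u\<close> between 0 and 1.\<close>
    have "(1 - u) *\<^sub>R (p + \<epsilon> m *\<^sub>R ?a) + u *\<^sub>R (p + \<epsilon> m *\<^sub>R ?b)
        = p + \<epsilon> m *\<^sub>R (v + ((2 * u - 1) * \<epsilon> n) *\<^sub>R \<nu>)"
      by (simp add: algebra_simps flip: scaleR_2)
    moreover have "\<epsilon> m \<le> \<epsilon> n" using m(4) by (simp add: \<epsilon>_def)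
    moreover have "\<bar>2 * u - 1\<bar> * \<epsilon> n * norm \<nu> \<le> 1 * \<epsilon> n * norm \<nu>"
      using u \<epsilon>[of n] by (intro mult_right_mono) auto
    then have "norm (v + ((2 * u - 1) * \<epsilon> n) *\<^sub>R \<nu> - v) \<le> \<epsilon> n * norm \<nu>"
      using \<epsilon>[of n] by (simp add: abs_mult)
    ultimately show ?thesis using x \<epsilon>[of m]
      by (intro exI[of _ "\<epsilon> m"] exI[of _ "v + ((2 * u - 1) * \<epsilon> n) *\<^sub>R \<nu>"]) simp
  qed
  then obtain s w where sw: "\<And>n. 0 < s n" "\<And>n. s n \<le> \<epsilon> n" "\<And>n. norm (w n - v) \<le> \<epsilon> n * norm \<nu>"
      "\<And>n. p + s n *\<^sub>R w n \<in> frontier \<Omega>"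
    by metis
  have "s \<longlonglongrightarrow> 0"
    by (rule real_tendsto_sandwich[OF _ _ tendsto_const \<epsilon>_lim])
       (use sw(1,2) in \<open>auto intro!: always_eventually less_imp_le\<close>)
  moreover have "(\<lambda>n. norm (w n - v)) \<longlonglongrightarrow> 0"
    by (rule real_tendsto_sandwich[OF _ _ tendsto_const tendsto_mult_left_zero[OF \<epsilon>_lim, of "norm \<nu>"]])
       (use sw in auto)
  then have "w \<longlonglongrightarrow> v" by (simp add: LIM_zero_iff tendsto_norm_zero_iff)
  ultimately show ?thesis using that sw by blast
qed

lemma derivative_zero_on_tangent:
  assumes p: "p \<in> frontier \<Omega>" and v: "frechet_derivative r (at p) v = 0"
    and U: "open U" "p \<in> U" and u: "\<And>z. z \<in> frontier \<Omega> \<Longrightarrow> z \<in> U \<Longrightarrow> u z = 0"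
    and D: "(u has_derivative u') (at p)"
  shows "u' v = 0"
proof -
  obtain t w where tw: "\<And>n. 0 < t n" "t \<longlonglongrightarrow> 0" "w \<longlonglongrightarrow> v" "\<And>n. p + t n *\<^sub>R w n \<in> frontier \<Omega>"
    using tangent_sequence[OF p v] by blast
  have "(\<lambda>n. p + t n *\<^sub>R w n) \<longlonglongrightarrow> p"
    by (rule tendsto_add_scaled[OF tw(2,3)])
  then have "\<forall>\<^sub>F n in sequentially. p + t n *\<^sub>R w n \<in> U"
    using U by (rule topological_tendstoD)
  then have "\<forall>\<^sub>F n in sequentially. (u (p + t n *\<^sub>R w n) - u p) /\<^sub>R t n = 0"
    by eventually_elim (use u tw(4) p U(2) in simp)
  then have "(\<lambda>n. (u (p + t n *\<^sub>R w n) - u p) /\<^sub>R t n) \<longlonglongrightarrow> 0"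
    by (rule tendsto_eventually)
  then show ?thesis
    using difference_quotient_tendsto[OF D tw(1-3)] LIMSEQ_unique by blast
qed

lemma derivative_nonneg_on_tangent:
  fixes \<phi> :: "complex^'n \<Rightarrow> real"
  assumes p: "p \<in> frontier \<Omega>" and v: "frechet_derivative r (at p) v = 0"
    and U: "open U" "p \<in> U" and \<phi>: "\<And>z. z \<in> frontier \<Omega> \<Longrightarrow> z \<in> U \<Longrightarrow> 0 \<le> \<phi> z" "\<phi> p = 0"
    and D: "(\<phi> has_derivative \<phi>') (at p)"
  shows "0 \<le> \<phi>' v"
proof -
  obtain t w where tw: "\<And>n. 0 < t n" "t \<longlonglongrightarrow> 0" "w \<longlonglongrightarrow> v" "\<And>n. p + t n *\<^sub>R w n \<in> frontier \<Omega>"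
    using tangent_sequence[OF p v] by blast
  have "(\<lambda>n. p + t n *\<^sub>R w n) \<longlonglongrightarrow> p"
    by (rule tendsto_add_scaled[OF tw(2,3)])
  then have "\<forall>\<^sub>F n in sequentially. p + t n *\<^sub>R w n \<in> U"
    using U by (rule topological_tendstoD)
  then have "\<forall>\<^sub>F n in sequentially. 0 \<le> (\<phi> (p + t n *\<^sub>R w n) - \<phi> p) /\<^sub>R t n"
    by eventually_elim (use \<phi> tw(1,4) in \<open>simp add: less_imp_le\<close>)
  then show ?thesis
    using difference_quotient_tendsto[OF D tw(1-3)] by (intro tendsto_lowerbound) auto
qed

lemma act_zero_iff_tangent:
  assumes "p \<in> frontier \<Omega>"
  shows "cvec_act Z R p = 0 \<longleftrightarrow>
    frechet_derivative r (at p) (cvec_re Z) = 0 \<and> frechet_derivative r (at p) (cvec_im Z) = 0"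
  by (simp add: cvec_act_of_real[OF r_differentiable[OF frontier_V[OF assms]]] complex_eq_iff)

lemma act_zero_on_tangent:
  assumes p: "p \<in> frontier \<Omega>" and Z: "cvec_act Z R p = 0"
    and U: "open U" "p \<in> U" and u: "\<And>z. z \<in> frontier \<Omega> \<Longrightarrow> z \<in> U \<Longrightarrow> u z = 0"
    and D: "u differentiable (at p)"
  shows "cvec_act Z u p = 0"
proof -
  have "frechet_derivative u (at p) v = 0" if "frechet_derivative r (at p) v = 0" for v
    by (rule derivative_zero_on_tangent[OF p that U u D[unfolded frechet_derivative_works]])
  then show ?thesis
    using Z D by (simp add: cvec_act_frechet act_zero_iff_tangent[OF p])
qed

text \<open>At a minimum on the boundary the one-sided inequality holds for \<open>v\<close> and for
  \<open>- v\<close>, so real tangential derivatives vanish; complex ones follow from their real and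
  imaginary parts.\<close>

lemma act_zero_at_minimum:
  assumes p: "p \<in> frontier \<Omega>" and Z: "cvec_act Z R p = 0"
    and U: "open U" "p \<in> U" and \<phi>: "\<And>z. z \<in> frontier \<Omega> \<Longrightarrow> z \<in> U \<Longrightarrow> 0 \<le> Re (\<phi> z)"
      "\<And>z. z \<in> U \<Longrightarrow> Im (\<phi> z) = 0" "\<phi> p = 0"
    and D: "\<phi> differentiable (at p)"
  shows "cvec_act Z \<phi> p = 0"
proof -
  have D': "(\<phi> has_derivative frechet_derivative \<phi> (at p)) (at p)"
    using D frechet_derivative_works by blast
  have lin: "linear (frechet_derivative \<phi> (at p))" "linear (frechet_derivative r (at p))"
    using linear_frechet_derivative[OF D] linear_frechet_derivative[OF r_differentiable[OF frontier_V[OF p]]] .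
  have "frechet_derivative \<phi> (at p) v = 0" if v: "frechet_derivative r (at p) v = 0" for v
  proof -
    have "0 \<le> Re (frechet_derivative \<phi> (at p) v)" if v: "frechet_derivative r (at p) v = 0" for v
      using derivative_nonneg_on_tangent[OF p v U _ _ bounded_linear.has_derivative[OF bounded_linear_Re D']] \<phi> by simp
    from this[of v] this[of "- v"] have "Re (frechet_derivative \<phi> (at p) v) = 0"
      using v by (simp add: linear_neg[OF lin(1)] linear_neg[OF lin(2)])
    moreover have "Im (frechet_derivative \<phi> (at p) v) = 0"
      using derivative_zero_on_tangent[OF p v U _ bounded_linear.has_derivative[OF bounded_linear_Im D']] \<phi>(2) by simp
    ultimately show ?thesis by (simp add: complex_eq_iff)
  qed
  then show ?thesis
    using Z D by (simp add: cvec_act_frechet act_zero_iff_tangent[OF p])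
qed

lemma act_nonzero:
  assumes "p \<in> frontier \<Omega>"
  obtains \<nu> where "cvec_act \<nu> R p \<noteq> 0"
proof -
  obtain v where "frechet_derivative r (at p) v = 1" using dr_eq_1[OF assms] .
  moreover have "cvec_re (v, \<chi> j. cnj (v $ j)) = v" by (simp add: cvec_re_def vec_eq_iff)
  ultimately have "cvec_act (v, \<chi> j. cnj (v $ j)) R p \<noteq> 0"
    using act_zero_iff_tangent[OF assms, of "(v, \<chi> j. cnj (v $ j))"] by simp
  then show ?thesis by (rule that)
qed

text \<open>The combination \<open>(Y R) X - (X R) Y\<close> kills \<open>R\<close>, hence is
  tangential and kills \<open>S\<close>. This expresses dS = h dR without the factor h, which would
  be less smooth than \<open>S\<close> and \<open>R\<close>.\<close>

lemma differential_proportional: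
  assumes p: "p \<in> frontier \<Omega>" and U: "open U" "p \<in> U"
    and S: "\<And>z. z \<in> frontier \<Omega> \<Longrightarrow> z \<in> U \<Longrightarrow> S z = 0" "S differentiable (at p)"
  shows "cvec_act X S p * cvec_act Y R p = cvec_act Y S p * cvec_act X R p"
proof -
  let ?Z = "cvec_scale (cvec_act Y R p) X - cvec_scale (cvec_act X R p) Y"
  have "cvec_act ?Z R p = 0"
    by (simp add: cvec_act_diff_vec cvec_act_scale_vec)
  then have "cvec_act ?Z S p = 0"
    by (rule act_zero_on_tangent[OF p _ U S])
  then show ?thesis
    by (simp add: cvec_act_diff_vec cvec_act_scale_vec mult.commute)
qed

text \<open>Differentiate \<open>differential_proportional\<close> along the boundary.\<close>

lemma hessian_proportional:
  assumes p: "p \<in> frontier \<Omega>" and U: "open U" "p \<in> U" "U \<subseteq> V"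
    and S: "\<And>z. z \<in> frontier \<Omega> \<Longrightarrow> z \<in> U \<Longrightarrow> S z = 0" "Ck_on 2 S U"
    and Z: "cvec_act Z R p = 0" and X: "cvec_act X R p = 0"
  shows "cvec_act Z (cvec_act X S) p * cvec_act Y R p = cvec_act Y S p * cvec_act Z (cvec_act X R) p"
proof -
  \<comment> \<open>\<open>?G\<close> vanishes at all boundary points near \<open>p\<close>. In its
    \<open>Z\<close>-derivative the terms containing \<open>X S\<close> and \<open>X R\<close>
    undifferentiated drop out at \<open>p\<close>.\<close>
  let ?G = "\<lambda>z. cvec_act X S z * cvec_act Y R z - cvec_act Y S z * cvec_act X R z"
  have dS: "cvec_act X S differentiable (at p)" for X
    using cvec_act_differentiable[OF S(2) U(1,2)] by simp
  have dR: "cvec_act X R differentiable (at p)" for X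
    using cvec_act_differentiable[OF R_C2 open_V frontier_V[OF p]] by simp
  have "?G z = 0" if "z \<in> frontier \<Omega>" "z \<in> U" for z
    using differential_proportional[OF that(1) U(1) that(2) S(1) Ck_on_imp_differentiable[OF S(2) U(1) that(2)]]
    by simp
  then have "cvec_act Z ?G p = 0"
    using dS dR by (intro act_zero_on_tangent[OF p Z U(1,2)]) (auto intro!: differentiable_diff differentiable_mult)
  moreover have "cvec_act X S p = 0"
  proof -
    obtain \<nu> where "cvec_act \<nu> R p \<noteq> 0" using act_nonzero[OF p] .
    then show ?thesis
      using differential_proportional[OF p U(1,2) S(1) Ck_on_imp_differentiable[OF S(2) U(1,2)], of X \<nu>] X by simp
  qed
  ultimately show ?thesis
    using dS dR X by (simp add: cvec_act_diff cvec_act_mult)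
qed

lemma levi_form_eq:
  assumes "p \<in> V" "snd X = 0" "snd Y = 0"
  shows "levi_form r p X Y = cvec_act X (cvec_act (cvec_cnj Y) R) p"
proof -
  have *: "dz j (dzbar k R) p = cvec_act (axis j 1, 0) (dzbar k R) p" for j k
    by (simp add: dz_eq_cvec_act)
  have "cvec_act X (cvec_act (cvec_cnj Y) R) p =
      (\<Sum>k\<in>UNIV. cnj (fst Y $ k) * cvec_act X (dzbar k R) p)"
    using assms by (simp add: cvec_act_act_expand[OF R_C2 open_V assms(1)])
  also have "\<dots> = (\<Sum>k\<in>UNIV. \<Sum>j\<in>UNIV. dz j (dzbar k R) p * fst X $ j * cnj (fst Y $ k))"
    using assms(2) by (simp add: cvec_act_expand[of X] sum_distrib_left algebra_simps)
  also have "\<dots> = levi_form r p X Y"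
    unfolding levi_form_def by (rule sum.swap)
  finally show ?thesis by simp
qed

end

section \<open>Comparison of two defining functions\<close>

lemma domain_boundaryI:
  assumes "open \<Omega>" "defining_function k r \<Omega>" "2 \<le> k"
  obtains V where "domain_boundary \<Omega> r V" "Ck_on k r V"
  using assms Ck_on_mono[of k r _ 2] unfolding defining_function_def domain_boundary_def by blast

text \<open>Positivity of the factor between the two differentials: a direction in which
  \<open>r\<close> decreases leads into \<Omega>, where \<open>r'\<close> is negative. The
  derivative of \<open>r'\<close> cannot be zero there, since it already vanishes on the kernel of
  that of \<open>r\<close>.\<close>

lemma domain_boundary_sign:
  assumes "domain_boundary \<Omega> r V" "domain_boundary \<Omega> r' V'" "p \<in> frontier \<Omega>"
  obtains \<nu> where "frechet_derivative r (at p) \<nu> < 0" "frechet_derivative r' (at p) \<nu> < 0"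
proof -
  interpret A: domain_boundary \<Omega> r V by fact
  interpret B: domain_boundary \<Omega> r' V' by fact
  let ?D = "frechet_derivative r (at p)" and ?D' = "frechet_derivative r' (at p)"
  have pV: "p \<in> V" "p \<in> V'" using A.frontier_V B.frontier_V assms(3) by auto
  have lin: "linear ?D" "linear ?D'"
    using linear_frechet_derivative A.r_differentiable B.r_differentiable pV by blast+
  obtain v where "?D v = 1" using A.dr_eq_1[OF assms(3)] .
  then have n: "?D (- v) < 0" using linear_neg[OF lin(1)] by simp
  define \<epsilon> where "\<epsilon> n = inverse (real (Suc n))" for n
  have \<epsilon>: "0 < \<epsilon> n" for n by (simp add: \<epsilon>_def)
  have \<epsilon>_lim: "\<epsilon> \<longlonglongrightarrow> 0" unfolding \<epsilon>_def by (rule LIMSEQ_inverse_real_of_nat)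
  have "(\<lambda>m. r (p + \<epsilon> m *\<^sub>R - v) / \<epsilon> m) \<longlonglongrightarrow> ?D (- v)"
    using difference_quotient_tendsto[OF A.r_derivative[OF pV(1)] \<epsilon> \<epsilon>_lim tendsto_const, of "- v"]
    by (simp add: A.frontier_zero[OF assms(3)] divide_inverse_commute)
  then have "\<forall>\<^sub>F m in sequentially. r (p + \<epsilon> m *\<^sub>R - v) / \<epsilon> m < 0"
    using n by (rule order_tendstoD)
  moreover have "(\<lambda>m. p + \<epsilon> m *\<^sub>R - v) \<longlonglongrightarrow> p"
    by (rule tendsto_add_scaled[OF \<epsilon>_lim tendsto_const])
  then have "\<forall>\<^sub>F m in sequentially. p + \<epsilon> m *\<^sub>R - v \<in> V"
    using A.open_V pV(1) by (rule topological_tendstoD)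
  ultimately have "\<forall>\<^sub>F m in sequentially. (r' (p + \<epsilon> m *\<^sub>R - v) - r' p) /\<^sub>R \<epsilon> m \<le> 0"
  proof eventually_elim
    case (elim m)
    then have "p + \<epsilon> m *\<^sub>R - v \<in> \<Omega>"
      using \<epsilon>[of m] by (auto simp: A.\<Omega>_eq divide_less_0_iff)
    then have "r' (p + \<epsilon> m *\<^sub>R - v) < 0" using B.\<Omega>_eq by blast
    then show ?case
      using \<epsilon>[of m] B.frontier_zero[OF assms(3)] by (simp add: mult_nonneg_nonpos)
  qed
  then have "?D' (- v) \<le> 0"
    using difference_quotient_tendsto[OF B.r_derivative[OF pV(2)] \<epsilon> \<epsilon>_lim tendsto_const, of "- v"]
    by (intro tendsto_upperbound) auto
  moreover have "?D' (- v) \<noteq> 0"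
  proof
    assume 0: "?D' (- v) = 0"
    have "?D' w = 0" for w
    proof -
      have "?D (w - ?D w *\<^sub>R v) = 0"
        using \<open>?D v = 1\<close> by (simp add: linear_diff[OF lin(1)] linear_scale[OF lin(1)])
      then have "?D' (w - ?D w *\<^sub>R v) = 0"
        using A.derivative_zero_on_tangent[OF assms(3) _ open_UNIV UNIV_I B.frontier_zero B.r_derivative[OF pV(2)]] by simp
      then show ?thesis
        using 0 by (simp add: linear_diff[OF lin(2)] linear_scale[OF lin(2)] linear_neg[OF lin(2)])
    qed
    then show False using B.dr_nonzero[OF assms(3)] by auto
  qed
  ultimately show ?thesis using n that by force
qed

text \<open>\<open>pseudoconvex\<close> speaks of some defining function; on tangential vectors its
  Levi form and that of \<rho> are proportional with a positive factor.\<close>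

lemma pseudoconvex_levi_nonneg:
  assumes "pseudoconvex \<Omega>" "domain_boundary \<Omega> \<rho> V" "p \<in> frontier \<Omega>" "snd X = 0"
    and X: "cvec_act X (\<lambda>z. complex_of_real (\<rho> z)) p = 0"
  shows "0 \<le> Re (cvec_act X (cvec_act (cvec_cnj X) (\<lambda>z. complex_of_real (\<rho> z))) p)"
proof -
  interpret A: domain_boundary \<Omega> \<rho> V by fact
  obtain r where r: "defining_function 2 r \<Omega>"
    and levi: "\<And>p X. p \<in> frontier \<Omega> \<Longrightarrow> X \<in> T10 r p \<Longrightarrow> 0 \<le> Re (levi_form r p X X)"
    using assms(1) unfolding pseudoconvex_def by blast
  obtain V' where "domain_boundary \<Omega> r V'"
    using domain_boundaryI[OF A.open_\<Omega> r order_refl] .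
  then interpret B: domain_boundary \<Omega> r V' .
  obtain v where v: "frechet_derivative \<rho> (at p) v < 0" "frechet_derivative r (at p) v < 0"
    using domain_boundary_sign[OF assms(2) \<open>domain_boundary \<Omega> r V'\<close> assms(3)] .
  have pV: "p \<in> V" "p \<in> V'" using A.frontier_V B.frontier_V assms(3) by auto
  \<comment> \<open>A real vector in which both functions decrease, so the two coefficients in the
    proportionality are real and negative.\<close>
  define Y :: "'a cvec" where "Y = (v, \<chi> j. cnj (v $ j))"
  have "cvec_re Y = v" "cvec_im Y = 0"
    by (simp_all add: Y_def cvec_re_def cvec_im_def vec_eq_iff)
  then have Y: "cvec_act Y A.R p = complex_of_real (frechet_derivative \<rho> (at p) v)"
    "cvec_act Y B.R p = complex_of_real (frechet_derivative r (at p) v)"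
    using linear_0[OF linear_frechet_derivative[OF A.r_differentiable[OF pV(1)]]]
      linear_0[OF linear_frechet_derivative[OF B.r_differentiable[OF pV(2)]]]
    by (simp_all add: cvec_act_of_real A.r_differentiable[OF pV(1)] B.r_differentiable[OF pV(2)] complex_eq_iff)
  have R_diff: "A.R differentiable (at p)" "B.R differentiable (at p)"
    using Ck_on_imp_differentiable[OF A.R_C2 A.open_V pV(1)] Ck_on_imp_differentiable[OF B.R_C2 B.open_V pV(2)]
    by simp_all
  have X': "cvec_act X B.R p = 0"
    using A.differential_proportional[OF assms(3) open_UNIV UNIV_I _ R_diff(2), of X Y] B.frontier_zero X Y(1) v(1)
    by simp
  have "cvec_act X (cvec_act (cvec_cnj X) A.R) p * cvec_act Y B.R p
      = cvec_act Y A.R p * cvec_act X (cvec_act (cvec_cnj X) B.R) p"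
    using X' R_diff(2) pV A.R_C2 A.frontier_zero
    by (intro B.hessian_proportional[OF assms(3), of "V \<inter> V'"])
       (auto simp: cvec_act_cnj_real intro: Ck_on_subset_domain A.open_V B.open_V)
  also have "cvec_act X (cvec_act (cvec_cnj X) B.R) p = levi_form r p X X"
    by (rule B.levi_form_eq[OF pV(2) assms(4,4), symmetric])
  finally have "Re (cvec_act X (cvec_act (cvec_cnj X) A.R) p * complex_of_real (frechet_derivative r (at p) v))
      = Re (complex_of_real (frechet_derivative \<rho> (at p) v) * levi_form r p X X)"
    unfolding Y by simp
  then have "Re (cvec_act X (cvec_act (cvec_cnj X) A.R) p) * frechet_derivative r (at p) v
      = frechet_derivative \<rho> (at p) v * Re (levi_form r p X X)"
    by simp
  moreover have "X \<in> T10 r p"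
    using X' assms(4) by (simp add: T10_def cvec_act_expand)
  then have "0 \<le> Re (levi_form r p X X)" by (rule levi[OF assms(3)])
  then have "frechet_derivative \<rho> (at p) v * Re (levi_form r p X X) \<le> 0"
    using v(1) by (simp add: mult_nonpos_nonneg)
  ultimately show ?thesis
    using v(2) by (metis mult_le_0_iff not_le)
qed

section \<open>CR diffeomorphisms\<close>

lemma exists_dz_nonzero:
  fixes \<rho> :: "complex^'n::finite \<Rightarrow> real"
  assumes "(\<lambda>z. complex_of_real (\<rho> z)) differentiable (at p)"
    and "cvec_act X (\<lambda>z. complex_of_real (\<rho> z)) p \<noteq> 0"
  shows "\<exists>j. dz j (\<lambda>z. complex_of_real (\<rho> z)) p \<noteq> 0"
proof (rule ccontr)
  assume "\<not> ?thesis"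
  then have dz: "dz j (\<lambda>z. complex_of_real (\<rho> z)) p = 0" for j by simp
  have "dzbar j (\<lambda>z. complex_of_real (\<rho> z)) p = 0" for j
  proof -
    have "(0, axis j 1) = cvec_cnj (axis j (1::complex), 0)"
      by (simp add: cvec_cnj_def vec_eq_iff axis_def)
    then show ?thesis
      using cvec_act_cnj_real[OF assms(1)] dz[of j] by (simp add: dz_eq_cvec_act dzbar_eq_cvec_act)
  qed
  with dz assms(2) show False by (simp add: cvec_act_expand)
qed

lemma regular_function_near:
  fixes \<rho> :: "complex^'n::finite \<Rightarrow> real"
  assumes "open V" "Ck_on 3 \<rho> V" "p \<in> V" "cvec_act X (\<lambda>z. complex_of_real (\<rho> z)) p \<noteq> 0"
  obtains U where "regular_function \<rho> U" "p \<in> U" "U \<subseteq> V"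
proof -
  let ?R = "\<lambda>z. complex_of_real (\<rho> z)"
  have C3: "Ck_on 3 ?R V" by (rule Ck_on_of_real[OF assms(1,2)])
  let ?U = "\<Union>j. {z\<in>V. dz j ?R z \<noteq> 0}"
  have "continuous_on V (dz j ?R)" for j
    using dz_dzbar_Ck_on(1)[of 2 ?R V j] C3 assms(1) by (auto intro: Ck_on_imp_continuous_on)
  then have "open (V \<inter> dz j ?R -` (- {0}))" for j
    by (rule continuous_open_preimage[OF _ assms(1)]) auto
  moreover have "{z\<in>V. dz j ?R z \<noteq> 0} = V \<inter> dz j ?R -` (- {0})" for j by auto
  ultimately have "open {z\<in>V. dz j ?R z \<noteq> 0}" for j by simp
  then have "open ?U" by blast
  then have "regular_function \<rho> ?U"
    by (auto simp: regular_function_def intro: Ck_on_subset_domain[OF C3])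
  moreover have "p \<in> ?U"
    using exists_dz_nonzero[OF Ck_on_imp_differentiable[OF C3 assms(1,3)] assms(4)] assms(3) by auto
  ultimately show ?thesis using that by blast
qed

lemma vanishes_to_orderD: "vanishes_to_order m g S \<Longrightarrow> p \<in> S \<Longrightarrow> g p = 0"
  by (cases m) auto

lemma vanishes_to_order_2D:
  assumes "vanishes_to_order m g S" "2 \<le> m" "p \<in> S" "Ck_on 2 g UNIV"
  shows "g p = 0" "cvec_act X g p = 0" "cvec_act X (cvec_act Y g) p = 0"
proof -
  obtain m' where m: "m = Suc (Suc m')" using assms(2) by (metis Suc_le_D numeral_2_eq_2 Suc_le_mono)
  show "g p = 0" by (rule vanishes_to_orderD[OF assms(1,3)])
  have D1: "frechet_derivative g (at p) v = 0" for v
    using assms(1,3) by (auto simp: m)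
  have D2: "frechet_derivative (\<lambda>z. frechet_derivative g (at z) v) (at p) w = 0" for v w
    using assms(1,3) vanishes_to_orderD by (fastforce simp: m)
  have g: "g differentiable (at z)" for z
    using Ck_on_imp_differentiable[OF assms(4)] by simp
  show "cvec_act X g p = 0" by (simp add: cvec_act_frechet[OF g] D1)
  have dg: "(\<lambda>z. frechet_derivative g (at z) v) differentiable (at p)" for v
    using assms(4) differentiable_on_open_at[OF _ open_UNIV UNIV_I] by (auto simp: numeral_2_eq_2)
  have "cvec_act Y g = (\<lambda>z. frechet_derivative g (at z) (cvec_re Y) + \<i> * frechet_derivative g (at z) (cvec_im Y))"
    by (simp add: cvec_act_frechet[OF g] fun_eq_iff)
  then show "cvec_act X (cvec_act Y g) p = 0"
    using dg by (simp add: cvec_act_add cvec_act_cmult cvec_act_frechet D2)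
qed

text \<open>On a (0,1) vector the derivative of \<open>f\<close> is a constant-coefficient
  combination of \<open>dzbar\<close> terms, and \<open>k - 1\<close> is at least 2, so two further
  derivatives of it vanish.\<close>

lemma almost_holomorphic_atI:
  assumes "Ck_on k f UNIV" "3 \<le> k" "p \<in> S"
    and van: "\<And>j m. vanishes_to_order (k - 1) (dzbar m (\<lambda>z. f z $ j)) S"
    and "open U" "p \<in> U"
  shows "almost_holomorphic_at f p U"
proof -
  have f3: "Ck_on 3 f UNIV" by (rule Ck_on_mono[OF assms(1,2)])
  have fl: "Ck_on (Suc 2) (\<lambda>z. f z $ l) UNIV" for l
    using Ck_on_nth[OF open_UNIV f3] by simp
  have h2: "Ck_on 2 (dzbar j (\<lambda>z. f z $ l)) UNIV" for j l
    by (rule dz_dzbar_Ck_on(2)[OF fl open_UNIV])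
  have k: "2 \<le> k - 1" using assms(2) by simp
  note v = vanishes_to_order_2D[OF van k assms(3) h2]
  have Y0: "cvec_act Y (\<lambda>z. f z $ l) = (\<lambda>z. \<Sum>j\<in>UNIV. snd Y $ j * dzbar j (\<lambda>z. f z $ l) z)" if "fst Y = 0" for Y l
    using that by (simp add: cvec_act_expand fun_eq_iff)
  have d: "dzbar j (\<lambda>z. f z $ l) differentiable (at z)" "cvec_act X (dzbar j (\<lambda>z. f z $ l)) differentiable (at z)" for j l z X
    using Ck_on_imp_differentiable[OF h2 open_UNIV] cvec_act_differentiable[OF h2 open_UNIV] by simp_all
  have Y1: "cvec_act X (cvec_act Y (\<lambda>z. f z $ l)) = (\<lambda>z. \<Sum>j\<in>UNIV. snd Y $ j * cvec_act X (dzbar j (\<lambda>z. f z $ l)) z)" if "fst Y = 0" for X Y l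
    unfolding Y0[OF that] using d by (simp add: cvec_act_sum cvec_act_cmult fun_eq_iff)
  have Y2: "cvec_act W (cvec_act X (cvec_act Y (\<lambda>z. f z $ l))) p = (\<Sum>j\<in>UNIV. snd Y $ j * cvec_act W (cvec_act X (dzbar j (\<lambda>z. f z $ l))) p)" if "fst Y = 0" for W X Y l
    unfolding Y1[OF that] using d by (simp add: cvec_act_sum cvec_act_cmult)
  have 0: "cvec_act Y (\<lambda>z. f z $ l) p = 0" if "fst Y = 0" for Y l
    by (simp only: Y0[OF that]) (simp add: v)
  have 1: "cvec_act X (cvec_act Y (\<lambda>z. f z $ l)) p = 0" if "fst Y = 0" for X Y l
    by (simp only: Y1[OF that]) (simp add: v)
  have 2: "cvec_act W (cvec_act X (cvec_act Y (\<lambda>z. f z $ l))) p = 0" if "fst Y = 0" for W X Y l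
    by (simp only: Y2[OF that]) (simp add: v)
  show ?thesis
    by unfold_locales (simp_all add: 0 1 2 assms(5,6) Ck_on_subset_domain[OF f3])
qed

text \<open>A complex linear map that is injective on a real hyperplane is injective: every complex line meets the hyperplane.\<close>

lemma (in almost_holomorphic_at) pushforward_surjective:
  assumes "domain_boundary \<Omega> r V" and "p \<in> frontier \<Omega>"
    and inj: "\<And>v. frechet_derivative r (at p) v = 0 \<Longrightarrow> frechet_derivative f (at p) v = 0 \<Longrightarrow> v = 0"
    and "snd Y = 0"
  obtains X where "snd X = 0" "pushforward f p X = Y"
proof -
  interpret D: domain_boundary \<Omega> r V by fact
  define \<Phi> where "\<Phi> a = fst (pushforward f p (a, 0))" for a
  have scale: "\<Phi> (c *s a) = c *s \<Phi> a" for c a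
    using cvec_act_scale_vec[of c "(a, 0)" _ p]
    by (simp add: \<Phi>_def pushforward_def cvec_scale_def vec_eq_iff)
  have "\<Phi> (a + b) = \<Phi> a + \<Phi> b" for a b
    using cvec_act_plus_vec[of "(a, 0)" "(b, 0)" _ p]
    by (simp add: \<Phi>_def pushforward_def vec_eq_iff)
  moreover have "c *\<^sub>R a = complex_of_real c *s a" for c and a :: "complex^'n"
    by (simp add: vec_eq_iff scaleR_conv_of_real[where 'a=complex])
  ultimately have lin: "linear \<Phi>"
    by (intro linearI) (simp_all add: scale)
  have "a = 0" if "\<Phi> a = 0" for a
  proof -
    define \<gamma> where "\<gamma> = cvec_act (a, 0) D.R p"
    \<comment> \<open>Rotates \<open>a\<close> so that \<open>c * \<gamma>\<close> is imaginary: the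
      real part of the rotated vector is then tangent to the boundary.\<close>
    define c where "c = (if \<gamma> = 0 then 1 else \<i> * cnj \<gamma>)"
    have c: "c \<noteq> 0" "Re (c * \<gamma>) = 0" by (auto simp: c_def)
    let ?X = "(c *s a, 0 :: complex^'n)"
    have "pushforward f p ?X = 0"
      using scale[of c a] snd_pushforward[of ?X] that by (simp add: \<Phi>_def prod_eq_iff)
    then have f0: "frechet_derivative f (at p) (cvec_re ?X) = 0"
      using pushforward_parts(1)[OF f_differentiable, of ?X] by (simp add: cvec_re_def vec_eq_iff)
    have "cvec_act ?X D.R p = c * \<gamma>"
      using cvec_act_scale_vec[of c "(a, 0)" D.R p] by (simp add: cvec_scale_def \<gamma>_def)
    moreover have "Re (cvec_act ?X D.R p) = frechet_derivative r (at p) (cvec_re ?X)"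
      by (simp add: cvec_act_of_real[OF D.r_differentiable[OF D.frontier_V[OF assms(2)]]])
    ultimately have "frechet_derivative r (at p) (cvec_re ?X) = 0"
      using c(2) by metis
    then have "cvec_re ?X = 0" using inj f0 by blast
    then show ?thesis using c(1) by (simp add: cvec_re_def vec_eq_iff)
  qed
  then have "inj \<Phi>" using linear_injective_0[OF lin] by blast
  then have "surj \<Phi>" using linear_injective_imp_surjective[OF lin] by simp
  then obtain a where "\<Phi> a = fst Y" by (metis surjD)
  then have "pushforward f p (a, 0) = Y"
    using snd_pushforward[of "(a, 0)"] assms(4) by (simp add: \<Phi>_def prod_eq_iff)
  then show ?thesis using that[of "(a, 0)"] by simp
qed

text \<open>An extension \<open>G\<close> of the inverse satisfies \<open>G (f z) = z\<close> on the
  boundary, and this identity may be differentiated in tangential directions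
  \<open>v\<close>.\<close>

lemma CR_diffeomorphism_derivative_injective:
  assumes "CR_diffeomorphism k \<Omega>\<^sub>1 r \<Omega>\<^sub>2 \<rho> f" "1 \<le> k" "domain_boundary \<Omega>\<^sub>1 r V" "p \<in> frontier \<Omega>\<^sub>1"
    and f: "f differentiable (at p)"
    and v: "frechet_derivative r (at p) v = 0" "frechet_derivative f (at p) v = 0"
  shows "v = 0"
proof -
  interpret D: domain_boundary \<Omega>\<^sub>1 r V by fact
  have bij: "bij_betw f (frontier \<Omega>\<^sub>1) (frontier \<Omega>\<^sub>2)"
    using assms(1) by (simp add: CR_diffeomorphism_def)
  obtain U G where U: "open U" "frontier \<Omega>\<^sub>2 \<subseteq> U" "Ck_on k G U"
    and G: "\<And>y. y \<in> frontier \<Omega>\<^sub>2 \<Longrightarrow> G y = inv_into (frontier \<Omega>\<^sub>1) f y"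
    using assms(1) unfolding CR_diffeomorphism_def Ck_on_subset_def by blast
  have fp: "f p \<in> frontier \<Omega>\<^sub>2" using bij assms(4) bij_betwE by blast
  then have "G differentiable (at (f p))"
    using Ck_on_imp_differentiable[OF U(3,1) _ assms(2)] U(2) by blast
  then have "((\<lambda>z. G (f z)) has_derivative
      (\<lambda>w. frechet_derivative G (at (f p)) (frechet_derivative f (at p) w))) (at p)"
    using f unfolding frechet_derivative_works by (intro has_derivative_compose[of f _ p UNIV G])
  then have "((\<lambda>z. G (f z) - z) has_derivative
      (\<lambda>w. frechet_derivative G (at (f p)) (frechet_derivative f (at p) w) - w)) (at p)"
    by (intro has_derivative_diff has_derivative_ident)
  moreover have "G (f z) - z = 0" if "z \<in> frontier \<Omega>\<^sub>1" for z
    using that G bij by (simp add: bij_betwE bij_betw_inv_into_left)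
  ultimately have "frechet_derivative G (at (f p)) (frechet_derivative f (at p) v) - v = 0"
    using D.derivative_zero_on_tangent[OF assms(4) v(1) open_UNIV UNIV_I, of "\<lambda>z. G (f z) - z"] by blast
  then show ?thesis
    using v(2) linear_0[OF linear_frechet_derivative[OF \<open>G differentiable (at (f p))\<close>]] by simp
qed

text \<open>The Levi form is nonnegative along the boundary and \<open>levi_quadratic L\<close> vanishes at \<open>p\<close>, so its tangential derivative vanishes there.\<close>

lemma third_order_null:
  assumes "pseudoconvex \<Omega>" "domain_boundary \<Omega> \<rho> V" "regular_function \<rho> U" "p \<in> frontier \<Omega>" "p \<in> U"
    and L: "regular_function.levi_null_at \<rho> p L" and W: "snd W = 0" "cvec_act W (\<lambda>z. complex_of_real (\<rho> z)) p = 0"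
  shows "cvec_act W (cvec_act L (cvec_act (cvec_cnj L) (\<lambda>z. complex_of_real (\<rho> z)))) p =
    cvec_act W (cvec_act L (\<lambda>z. complex_of_real (\<rho> z))) p *
    cvec_act (normal_field \<rho> p) (cvec_act (cvec_cnj L) (\<lambda>z. complex_of_real (\<rho> z))) p"
proof -
  interpret D: domain_boundary \<Omega> \<rho> V by fact
  interpret Q: regular_function \<rho> U by fact
  have L0: "snd L = 0" and LR: "cvec_act L Q.R p = 0" using L by (simp_all add: Q.levi_null_at_def)
  have "cvec_act L (cvec_act (cvec_cnj L) Q.R) p = 0"
    using L L0 LR unfolding Q.levi_null_at_def by blast
  moreover have "Q.tangential L p = L" using LR by (simp add: Q.tangential_def cvec_scale_def prod_eq_iff)
  ultimately have zero: "Q.levi_quadratic L p = 0" by (simp add: Q.levi_quadratic_def)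
  have real: "Im (Q.levi_quadratic L z) = 0" if "z \<in> U" for z
  proof -
    let ?T = "Q.tangential L z"
    have "cnj (Q.levi_quadratic L z) = cvec_act (cvec_cnj ?T) (cvec_act ?T Q.R) z"
      using Q.R_cnj2[OF that, of ?T "cvec_cnj ?T"] by (simp add: Q.levi_quadratic_def)
    also have "\<dots> = Q.levi_quadratic L z"
      unfolding Q.levi_quadratic_def by (rule Q.R_commute[OF that])
    finally show ?thesis by (simp add: complex_eq_iff)
  qed
  have nonneg: "0 \<le> Re (Q.levi_quadratic L z)" if "z \<in> frontier \<Omega>" "z \<in> U" for z
    unfolding Q.levi_quadratic_def
    by (rule pseudoconvex_levi_nonneg[OF assms(1,2) that(1) Q.snd_tangential[OF L0] Q.act_tangential[OF that(2)]])
  have "cvec_act W (Q.levi_quadratic L) p = 0"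
    by (rule D.act_zero_at_minimum[OF assms(4) W(2) Q.open_U assms(5) nonneg real zero
          Q.act_levi_quadratic(1)[OF assms(5) L W]])
  then show ?thesis
    using Q.act_levi_quadratic(2)[OF assms(5) L W] by simp
qed

section \<open>Transport of null vectors and of the D'Angelo form\<close>

text \<open>The null space is given by \<open>r\<close>, while the D'Angelo form concerns another
  function \<open>s\<close> vanishing on the boundary. Since the normal field of \<open>s\<close>
  acts as 1 on \<open>s\<close>, both differentials have the same kernel, and the tangential
  Hessians are proportional.\<close>

lemma levi_null_at_of_levi_null_space:
  assumes "domain_boundary \<Omega> r V" "regular_function s U" "p \<in> frontier \<Omega>" "p \<in> U"
    and s0: "\<And>z. z \<in> frontier \<Omega> \<Longrightarrow> s z = 0"
    and L: "L \<in> levi_null_space r p"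
  shows "regular_function.levi_null_at s p L"
proof -
  interpret D: domain_boundary \<Omega> r V by fact
  interpret S: regular_function s U by fact
  have pV: "p \<in> V" by (rule D.frontier_V[OF assms(3)])
  have proportional: "cvec_act X S.R p * cvec_act Y D.R p = cvec_act Y S.R p * cvec_act X D.R p" for X Y
    using D.differential_proportional[OF assms(3) open_UNIV UNIV_I _ S.R_differentiable[OF assms(4)]] s0 by simp
  obtain \<mu> where \<mu>: "cvec_act \<mu> D.R p \<noteq> 0" using D.act_nonzero[OF assms(3)] .
  have S_imp_D: "cvec_act X D.R p = 0" if "cvec_act X S.R p = 0" for X
    using proportional[of X "S.N p"] that S.act_N_R[OF assms(4)] by simp
  have D_imp_S: "cvec_act X S.R p = 0" if "cvec_act X D.R p = 0" for X
    using proportional[of X \<mu>] that \<mu> by simp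
  have L0: "snd L = 0" and LD: "cvec_act L D.R p = 0"
    using L by (simp_all add: levi_null_space_def T10_def cvec_act_expand)
  show ?thesis
    unfolding S.levi_null_at_def
  proof (intro conjI allI impI)
    show "snd L = 0" "cvec_act L S.R p = 0" using L0 D_imp_S[OF LD] by simp_all
    fix X :: "'a cvec" assume X: "snd X = 0" "cvec_act X S.R p = 0"
    have XD: "cvec_act X D.R p = 0" by (rule S_imp_D[OF X(2)])
    then have "X \<in> T10 r p" using X(1) by (simp add: T10_def cvec_act_expand)
    then have "levi_form r p L X = 0"
      using L by (simp add: levi_null_space_def)
    then have "cvec_act L (cvec_act (cvec_cnj X) D.R) p = 0"
      using D.levi_form_eq[OF pV L0 X(1)] by simp
    \<comment> \<open>Hermitian symmetry moves \<open>L\<close> into the conjugated slot.\<close>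
    moreover have "cvec_act X (cvec_act (cvec_cnj L) D.R) p = cnj (cvec_act (cvec_cnj X) (cvec_act L D.R) p)"
      using cvec_act2_cnj[OF D.R_C2 order_refl D.open_V pV, of X "cvec_cnj L"] by simp
    moreover have "cvec_act (cvec_cnj X) (cvec_act L D.R) p = cvec_act L (cvec_act (cvec_cnj X) D.R) p"
      by (rule cvec_act_commute[OF D.R_C2 order_refl D.open_V pV])
    ultimately have 0: "cvec_act X (cvec_act (cvec_cnj L) D.R) p = 0" by simp
    have "cvec_act X (cvec_act (cvec_cnj L) S.R) p * cvec_act \<mu> D.R p = cvec_act \<mu> S.R p * cvec_act X (cvec_act (cvec_cnj L) D.R) p"
    proof (rule D.hessian_proportional[OF assms(3), of "U \<inter> V"])
      show "Ck_on 2 S.R (U \<inter> V)"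
        using Ck_on_subset_domain[OF Ck_on_mono[OF S.C3], of 2] by simp
      show "cvec_act (cvec_cnj L) D.R p = 0"
        using cvec_act_cnj_real[OF Ck_on_imp_differentiable[OF D.R_C2 D.open_V pV]] LD by simp
    qed (use S.open_U D.open_V assms(4) pV s0 XD in auto)
    then show "cvec_act X (cvec_act (cvec_cnj L) S.R) p = 0" using 0 \<mu> by simp
  qed
qed

text \<open>The hypothesis \<open>third\<close> isolates what is known from pseudoconvexity; the
  rest is calculus at one point.\<close>

lemma (in almost_holomorphic_at) dangelo_form_compose:
  assumes \<rho>: "regular_function \<rho> W" "f ` U \<subseteq> W" and s: "regular_function (\<lambda>z. \<rho> (f z)) U'" "p \<in> U'"
    and S_null: "regular_function.levi_null_at (\<lambda>z. \<rho> (f z)) p L"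
    and Q_null: "regular_function.levi_null_at \<rho> (f p) (pushforward f p L)"
    and third: "\<And>K. snd K = 0 \<Longrightarrow> cvec_act K (\<lambda>z. complex_of_real (\<rho> z)) (f p) = 0 \<Longrightarrow>
      cvec_act K (cvec_act (pushforward f p L) (cvec_act (cvec_cnj (pushforward f p L)) (\<lambda>z. complex_of_real (\<rho> z)))) (f p) =
      cvec_act K (cvec_act (pushforward f p L) (\<lambda>z. complex_of_real (\<rho> z))) (f p) *
      cvec_act (normal_field \<rho> (f p)) (cvec_act (cvec_cnj (pushforward f p L)) (\<lambda>z. complex_of_real (\<rho> z))) (f p)"
  shows "dangelo_form (\<lambda>z. \<rho> (f z)) p (cvec_cnj L) = dangelo_form \<rho> (f p) (cvec_cnj (pushforward f p L))"
    and "dc_form (dangelo_form (\<lambda>z. \<rho> (f z))) p L (cvec_cnj L) =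
      dc_form (dangelo_form \<rho>) (f p) (pushforward f p L) (cvec_cnj (pushforward f p L))"
proof -
  let ?s = "\<lambda>z. \<rho> (f z)" and ?q = "f p" and ?P = "pushforward f p"
  interpret Q: regular_function \<rho> W by fact
  interpret S: regular_function ?s U' by fact
  have q: "?q \<in> W" using \<rho>(2) p_in_U by blast
  note act_compose = act_compose[OF Q.open_U \<rho>(2) Q.C3]
    and act_mixed = act_compose_mixed[OF Q.open_U \<rho>(2) Q.C3]
    and act_second = act_compose_second[OF Q.open_U \<rho>(2) Q.C3]
    and act_third = act_compose_third[OF Q.open_U \<rho>(2) Q.C3]
  let ?N = "S.N p" and ?M = "Q.N ?q"
  let ?Lb = "cvec_cnj (?P L)"
  let ?m = "cvec_act ?M (cvec_act ?Lb Q.R) ?q"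
  have L0: "snd L = 0" using S_null by (simp add: S.levi_null_at_def)
  have PL0: "snd (?P L) = 0" by (rule snd_pushforward[OF L0])
  have Lb0: "fst (cvec_cnj L) = 0" "fst ?Lb = 0" using L0 PL0 by simp_all
  have PN0: "snd (?P ?N) = 0" by (rule snd_pushforward[OF S.snd_N])
  have PN1: "cvec_act (?P ?N) Q.R ?q = 1"
    using S.act_N_R[OF s(2)] act_compose[of ?N] by simp
  have N_mixed: "cvec_act ?N (cvec_act (cvec_cnj L) S.R) p = ?m"
    using act_mixed[OF S.snd_N Lb0(1)] Q.null_split[OF q Q_null PN0] PN1 by (simp add: pushforward_cnj)
  show "dangelo_form ?s p (cvec_cnj L) = dangelo_form \<rho> ?q ?Lb"
    using S.dangelo_form_01[OF s(2) Lb0(1)] Q.dangelo_form_01[OF q Lb0(2)] N_mixed by simp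
  \<comment> \<open>Both vectors act as 1 on \<rho>, so their difference is tangential and
    \<open>third\<close> applies to it.\<close>
  let ?K = "?P ?N - ?M"
  have K: "snd ?K = 0" "cvec_act ?K Q.R ?q = 0"
    using PN0 PN1 Q.act_N_R[OF q] by (simp_all add: cvec_act_diff_vec)
  have comm: "cvec_act (?P L) (cvec_act X (cvec_act ?Lb Q.R)) ?q = cvec_act X (cvec_act (?P L) (cvec_act ?Lb Q.R)) ?q" for X
    by (rule cvec_act_commute[OF Q.dR_C2 order_refl Q.open_U q])
  \<comment> \<open>The expression is linear in the normal vector and vanishes on \<open>?K\<close>,
    so it takes the same value on the transported and on the intrinsic normal.\<close>
  have normal: "cvec_act (?P L) (cvec_act (?P ?N) (cvec_act ?Lb Q.R)) ?q - cvec_act (?P L) (cvec_act (?P ?N) Q.R) ?q * ?m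
      = cvec_act (?P L) (cvec_act ?M (cvec_act ?Lb Q.R)) ?q - cvec_act (?P L) (cvec_act ?M Q.R) ?q * ?m"
    using third[OF K] by (simp add: comm cvec_act_diff_vec Q.R_commute[OF q, of "?P L"] algebra_simps)
  have V_mixed: "cvec_act (pushforward2 f p L ?N) (cvec_act ?Lb Q.R) ?q = cvec_act (pushforward2 f p L ?N) Q.R ?q * ?m"
    by (rule Q.null_split[OF q Q_null snd_pushforward2[OF L0]])
  have 3: "cvec_act L (cvec_act ?N (cvec_act (cvec_cnj L) S.R)) p =
      cvec_act (pushforward2 f p L ?N) Q.R ?q * ?m + cvec_act (?P L) (cvec_act (?P ?N) (cvec_act ?Lb Q.R)) ?q"
    using act_third[OF S.snd_N Lb0(1) L0] V_mixed by (simp add: pushforward_cnj)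
  \<comment> \<open>The Hessian of \<open>f\<close> occurs in the third derivative and, times
    \<open>?m\<close>, in the correction term; the two contributions cancel.\<close>
  have "cvec_act L (\<lambda>z. dangelo_form ?s z (cvec_cnj L)) p = cvec_act (?P L) (\<lambda>z. dangelo_form \<rho> z ?Lb) ?q"
    unfolding S.act_dangelo_form_null[OF s(2) S_null] Q.act_dangelo_form_null[OF q Q_null] N_mixed 3
      act_second[of L ?N] normal[symmetric]
    by (simp add: algebra_simps)
  then show "dc_form (dangelo_form ?s) p L (cvec_cnj L) = dc_form (dangelo_form \<rho>) ?q (?P L) ?Lb"
    by (simp add: S.dc_dangelo_form[OF s(2) L0] Q.dc_dangelo_form[OF q PL0])
qed

text \<open>By surjectivity every tangential test vector at \<open>f p\<close> is the image of a
  (1,0) vector at \<open>p\<close>, itself tangential by the chain rule.\<close>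

lemma (in almost_holomorphic_at) levi_null_at_pushforward:
  assumes \<rho>: "regular_function \<rho> W" "f ` U \<subseteq> W" and s: "regular_function (\<lambda>z. \<rho> (f z)) U'" "p \<in> U'"
    and S_null: "regular_function.levi_null_at (\<lambda>z. \<rho> (f z)) p L"
    and surj: "\<And>Y. snd Y = 0 \<Longrightarrow> \<exists>X. snd X = 0 \<and> pushforward f p X = Y"
  shows "regular_function.levi_null_at \<rho> (f p) (pushforward f p L)"
proof -
  interpret Q: regular_function \<rho> W by fact
  interpret S: regular_function "\<lambda>z. \<rho> (f z)" U' by fact
  note act_compose = act_compose[OF Q.open_U \<rho>(2) Q.C3]
    and act_mixed = act_compose_mixed[OF Q.open_U \<rho>(2) Q.C3]
  have L: "snd L = 0" "cvec_act L S.R p = 0"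
    "\<And>X. snd X = 0 \<Longrightarrow> cvec_act X S.R p = 0 \<Longrightarrow> cvec_act X (cvec_act (cvec_cnj L) S.R) p = 0"
    using S_null unfolding S.levi_null_at_def by blast+
  show ?thesis
    unfolding Q.levi_null_at_def
  proof (intro conjI allI impI)
    show "snd (pushforward f p L) = 0" by (rule snd_pushforward[OF L(1)])
    show "cvec_act (pushforward f p L) Q.R (f p) = 0" using L(2) act_compose[of L] by simp
    fix Y :: "'n cvec" assume Y: "snd Y = 0" "cvec_act Y Q.R (f p) = 0"
    obtain X where X: "snd X = 0" "pushforward f p X = Y" using surj[OF Y(1)] by blast
    then have "cvec_act X S.R p = 0" using Y(2) act_compose[of X] by simp
    then have "cvec_act X (cvec_act (cvec_cnj L) S.R) p = 0" by (rule L(3)[OF X(1)])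
    then show "cvec_act Y (cvec_act (cvec_cnj (pushforward f p L)) Q.R) (f p) = 0"
      using act_mixed[OF X(1), of "cvec_cnj L"] L(1) X(2) by (simp add: pushforward_cnj)
  qed
qed

theorem proposition5p3:
  fixes \<Omega>\<^sub>1 \<Omega>\<^sub>2 :: "(complex^'n::finite) set"
    and r \<rho> :: "complex^'n \<Rightarrow> real"
    and f :: "complex^'n \<Rightarrow> complex^'n"
    and k :: nat
  assumes "CARD('n) \<ge> 2" and "k \<ge> 3"
    and "open \<Omega>\<^sub>1" "connected \<Omega>\<^sub>1" "\<Omega>\<^sub>1 \<noteq> {}" "bounded \<Omega>\<^sub>1" "pseudoconvex \<Omega>\<^sub>1"
    and "open \<Omega>\<^sub>2" "connected \<Omega>\<^sub>2" "\<Omega>\<^sub>2 \<noteq> {}" "bounded \<Omega>\<^sub>2" "pseudoconvex \<Omega>\<^sub>2"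
    and "defining_function k r \<Omega>\<^sub>1"
    and "defining_function k \<rho> \<Omega>\<^sub>2"
    and "CR_diffeomorphism k \<Omega>\<^sub>1 r \<Omega>\<^sub>2 \<rho> f"
    and "Ck_on k f UNIV"
    and "\<And>j m. vanishes_to_order (k - 1) (dzbar m (\<lambda>z. f z $ j)) (frontier \<Omega>\<^sub>1)"
  shows "\<forall>p\<in>frontier \<Omega>\<^sub>1. \<forall>L\<in>levi_null_space r p.
      dangelo_form (\<rho> \<circ> f) p (cvec_cnj L)
        = dangelo_form \<rho> (f p) (cvec_cnj (pushforward f p L)) \<and>
      dc_form (dangelo_form (\<rho> \<circ> f)) p L (cvec_cnj L)
        = dc_form (dangelo_form \<rho>) (f p) (pushforward f p L) (cvec_cnj (pushforward f p L))"
proof (intro ballI)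
  fix p L
  assume p: "p \<in> frontier \<Omega>\<^sub>1" and L: "L \<in> levi_null_space r p"
  have k: "2 \<le> k" "1 \<le> k" using assms(2) by simp_all
  obtain V1 where V1: "domain_boundary \<Omega>\<^sub>1 r V1" "Ck_on k r V1"
    by (rule domain_boundaryI[OF assms(3,13) k(1)])
  obtain V2 where V2: "domain_boundary \<Omega>\<^sub>2 \<rho> V2" "Ck_on k \<rho> V2"
    by (rule domain_boundaryI[OF assms(8,14) k(1)])
  note open_V2 = domain_boundary.open_V[OF V2(1)]
  have f_frontier: "f z \<in> frontier \<Omega>\<^sub>2" if "z \<in> frontier \<Omega>\<^sub>1" for z
    using assms(15) that by (auto simp: CR_diffeomorphism_def CR_map_def)
  have q: "f p \<in> frontier \<Omega>\<^sub>2" by (rule f_frontier[OF p])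
  have \<rho>3: "Ck_on 3 \<rho> V2" by (rule Ck_on_mono[OF V2(2) assms(2)])
  have f3: "Ck_on 3 f UNIV" by (rule Ck_on_mono[OF assms(16,2)])
  obtain \<nu> where "cvec_act \<nu> (\<lambda>z. complex_of_real (\<rho> z)) (f p) \<noteq> 0"
    by (rule domain_boundary.act_nonzero[OF V2(1) q])
  then obtain W where W: "regular_function \<rho> W" "f p \<in> W" "W \<subseteq> V2"
    by (rule regular_function_near[OF open_V2 \<rho>3 domain_boundary.frontier_V[OF V2(1) q]])
  note open_W = regular_function.open_U[OF W(1)]
  have U: "open (f -` W)" "p \<in> f -` W" "f ` (f -` W) \<subseteq> W"
    using open_vimage[OF open_W Ck_on_imp_continuous_on[OF f3]] W(2) by auto
  have F: "almost_holomorphic_at f p (f -` W)"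
    by (rule almost_holomorphic_atI[OF assms(16,2) p assms(17) U(1,2)])
  have surj: "\<exists>X. snd X = 0 \<and> pushforward f p X = Y" if "snd Y = 0" for Y
    using almost_holomorphic_at.pushforward_surjective[OF F V1(1) p _ that]
      CR_diffeomorphism_derivative_injective[OF assms(15) k(2) V1(1) p almost_holomorphic_at.f_differentiable[OF F]]
    by metis
  \<comment> \<open>A preimage of the normal vector differentiates \<rho> o f to 1, so the composite
    is regular near \<open>p\<close>.\<close>
  obtain N' where "snd N' = 0" "pushforward f p N' = normal_field \<rho> (f p)"
    using surj[OF regular_function.snd_N[OF W(1)]] by blast
  then have "cvec_act N' (\<lambda>z. complex_of_real (\<rho> (f z))) p \<noteq> 0"
    using almost_holomorphic_at.act_compose[OF F open_W U(3) regular_function.C3[OF W(1)], of N']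
      regular_function.act_N_R[OF W(1,2)] by simp
  then obtain U' where U': "regular_function (\<lambda>z. \<rho> (f z)) U'" "p \<in> U'" "U' \<subseteq> f -` W"
    by (rule regular_function_near[OF U(1)
          Ck_on_compose[OF U(1) open_W U(3) Ck_on_subset_domain[OF f3 subset_UNIV] Ck_on_subset_domain[OF \<rho>3 W(3)]]
          U(2)])
  have S_null: "regular_function.levi_null_at (\<lambda>z. \<rho> (f z)) p L"
    using levi_null_at_of_levi_null_space[OF V1(1) U'(1) p U'(2) _ L]
      domain_boundary.frontier_zero[OF V2(1) f_frontier] by simp
  have Q_null: "regular_function.levi_null_at \<rho> (f p) (pushforward f p L)"
    by (rule almost_holomorphic_at.levi_null_at_pushforward[OF F W(1) U(3) U'(1,2) S_null surj])
  note third = third_order_null[OF assms(12) V2(1) W(1) q W(2) Q_null]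
  show "dangelo_form (\<rho> \<circ> f) p (cvec_cnj L) = dangelo_form \<rho> (f p) (cvec_cnj (pushforward f p L)) \<and>
      dc_form (dangelo_form (\<rho> \<circ> f)) p L (cvec_cnj L)
        = dc_form (dangelo_form \<rho>) (f p) (pushforward f p L) (cvec_cnj (pushforward f p L))"
    using almost_holomorphic_at.dangelo_form_compose[OF F W(1) U(3) U'(1,2) S_null Q_null third]
    by (simp add: comp_def)
qed

end
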